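(* Let $j:X\times X\to[0,\infty]$ be measurable, symmetric ($j(x,y)=j(y,x)$) and finite outside the diagonal $d$, and assume that the set $\tilde{\mathcal D}$ of all $u\in C_c(X)$ with $$\int_{X\times X\setminus d}(u(x)-u(y))^2\,j(x,y)\,m(dx)\,m(dy)<\infty$$ is dense in $C_c(X)$ with respect to the supremum norm. Let $\mathcal E$ be the regular Dirichlet form on $L^2(X,m)$ obtained as the closure of the form $u\mapsto\int_{X\times X\setminus d}(u(x)-u(y))^2 j(x,y)\,m(dx)\,m(dy)$ defined on $\tilde{\mathcal D}$. Let $\varrho$ be a continuous pseudo-metric on $X$ such that $$\int_{X\setminus\{x\}}\varrho(x,y)^2\,j(x,y)\,m(dy)\le 1$$ for $m$-almost all $x\in X$. Then $\varrho$ is an intrinsic metric for $\mathcal E$.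
   Context: $X$ is a locally compact separable metric space, $m$ a positive Radon measure on $X$ with $\operatorname{supp} m=X$; functions are real valued; $C(X)$ and $C_c(X)$ are the continuous, respectively continuous compactly supported, functions; $d=\{(x,x):x\in X\}$. The form on $\tilde{\mathcal D}$ is closable; $\mathcal D$ denotes the domain of its closure $\mathcal E$, i.e. the closure of $\tilde{\mathcal D}$ with respect to $\sqrt{\mathcal E_1}$, $\mathcal E_1(u)=\mathcal E(u)+\|u\|^2_{L^2}$ (where $q(u):=q(u,u)$ for bilinear $q$). For a general regular Dirichlet form one has the Beurling–Deny formula $$\mathcal E(u)=\int_{X\times X\setminus d}(\tilde u(x)-\tilde u(y))^2\,J(dx,dy)+\int_X d\mu^{(c)}(u)+\int_X\tilde u^2\,dk,\quad u\in\mathcal D,$$ with $\tilde u$ a quasi-continuous representative of $u$, $k$ and $J$ non-negative Radon measures ($J$ on $X\times X\setminus d$), and $\mu^{(c)}$ a strongly local measure-valued positive semidefinite bilinear form. In the present situation $J(dx,dy)=j(x,y)\,m(dx)\,m(dy)$, $\mu^{(c)}=0$ and $k=0$. $\mathcal D_{loc}$ is the set of $u\in L^2_{loc}$ such that for every open relatively compact $G\subset X$ there is $v\in\mathcal D$ with $u=v$ on $G$. $\mathcal D_{loc}^*$ is the set of $u\in\mathcal D_{loc}$ with $\int_{K\times X\setminus d}(\tilde u(x)-\tilde u(y))^2J(dx,dy)<\infty$ for all compact $K\subset X$. For $u\in\mathcal D_{loc}^*$ put $\mu^{(b)}(u)(E)=\int_{E\times X\setminus d}(\tilde u(x)-\tilde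 u(y))^2J(dx,dy)$ for measurable $E\subset X$. A pseudo-metric is a map $\varrho:X\times X\to[0,\infty]$ with $\varrho(x,x)=0$, symmetric, satisfying the triangle inequality; $\varrho_A(x):=\inf_{y\in A}\varrho(x,y)$ for $A\subset X$. A pseudo-metric $\varrho$ is an intrinsic metric for $\mathcal E$ if there are Radon measures $m_b,m_c$ with $m_b+m_c\le m$ such that for all $A\subset X$ and all $T>0$: $\varrho_A\wedge T\in\mathcal D_{loc}^*\cap C(X)$, $\mu^{(b)}(\varrho_A\wedge T)\le m_b$ and $\mu^{(c)}(\varrho_A\wedge T)\le m_c$. *)

theory Defs
  imports "HOL-Analysis.Analysis"
begin

text \<open>
  Functions are honest functions \<open>'a \<Rightarrow> real\<close>; elements of \<open>L\<^sup>2\<close> are represented by Borel functions and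
  all domains below are closed under almost everywhere equality. Forms are given by their quadratic
  part \<open>E u = E(u, u)\<close> together with a domain \<open>D\<close>. The diagonal is \<^const>\<open>Id\<close>.
\<close>

section \<open>Measures and function spaces\<close>

definition radon_measure_on :: "'a::topological_space set \<Rightarrow> 'a measure \<Rightarrow> bool" where
  "radon_measure_on S N \<longleftrightarrow>
     sets N = sets (restrict_space borel S) \<and>
     (\<forall>K. compact K \<and> K \<subseteq> S \<longrightarrow> emeasure N K < \<infinity>) \<and>
     (\<forall>B\<in>sets N. emeasure N B = (SUP K\<in>{K. compact K \<and> K \<subseteq> B}. emeasure N K))"

abbreviation radon_measure :: "'a::topological_space measure \<Rightarrow> bool" where
  "radon_measure \<equiv> radon_measure_on UNIV"

definition measure_support :: "'a::topological_space measure \<Rightarrow> 'a set" where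
  "measure_support M = {x. \<forall>U. open U \<and> x \<in> U \<longrightarrow> emeasure M U > 0}"

definition Cc :: "('a::topological_space \<Rightarrow> real) set" where
  "Cc = {u. continuous_on UNIV u \<and> compact (closure {x. u x \<noteq> 0})}"

definition sq_norm_L2 :: "'a measure \<Rightarrow> ('a \<Rightarrow> real) \<Rightarrow> ennreal" where
  "sq_norm_L2 M u = (\<integral>\<^sup>+x. ennreal ((u x)\<^sup>2) \<partial>M)"

definition L2 :: "'a measure \<Rightarrow> ('a \<Rightarrow> real) set" where
  "L2 M = {u \<in> borel_measurable M. sq_norm_L2 M u < \<infinity>}"

definition L2_loc :: "'a::topological_space measure \<Rightarrow> ('a \<Rightarrow> real) set" where
  "L2_loc M = {u \<in> borel_measurable M.
     \<forall>K. compact K \<longrightarrow> (\<integral>\<^sup>+x\<in>K. ennreal ((u x)\<^sup>2) \<partial>M) < \<infinity>}"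


section \<open>Closure of a form\<close>

text \<open>\<open>s\<close> is Cauchy with respect to \<open>E\<^sub>0\<close> and converges to \<open>u\<close> in \<open>L\<^sup>2\<close>; together this says that \<open>s\<close> is
  Cauchy for \<open>E\<^sub>0 + \<parallel>\<cdot>\<parallel>\<^sup>2\<close> with \<open>L\<^sup>2\<close>-limit \<open>u\<close>.\<close>

definition approximates ::
    "'a measure \<Rightarrow> ('a \<Rightarrow> real) set \<Rightarrow> (('a \<Rightarrow> real) \<Rightarrow> real) \<Rightarrow> (nat \<Rightarrow> 'a \<Rightarrow> real) \<Rightarrow> ('a \<Rightarrow> real) \<Rightarrow> bool"
  where
  "approximates M D0 E0 s u \<longleftrightarrow>
     (\<forall>n. s n \<in> D0) \<and>
     (\<forall>e>0. \<exists>N. \<forall>k\<ge>N. \<forall>l\<ge>N. E0 (\<lambda>x. s k x - s l x) < e) \<and>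
     (\<lambda>n. sq_norm_L2 M (\<lambda>x. s n x - u x)) \<longlonglongrightarrow> 0"

definition closure_domain ::
    "'a measure \<Rightarrow> ('a \<Rightarrow> real) set \<Rightarrow> (('a \<Rightarrow> real) \<Rightarrow> real) \<Rightarrow> ('a \<Rightarrow> real) set" where
  "closure_domain M D0 E0 = {u \<in> L2 M. \<exists>s. approximates M D0 E0 s u}"

text \<open>For a closable form the limit does not depend on the approximating sequence.\<close>

definition closure_form ::
    "'a measure \<Rightarrow> ('a \<Rightarrow> real) set \<Rightarrow> (('a \<Rightarrow> real) \<Rightarrow> real) \<Rightarrow> ('a \<Rightarrow> real) \<Rightarrow> real" where
  "closure_form M D0 E0 u = lim (\<lambda>n. E0 ((SOME s. approximates M D0 E0 s u) n))"


section \<open>Quasi-continuity\<close>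

definition open_capacity ::
    "'a::topological_space measure \<Rightarrow> ('a \<Rightarrow> real) set \<Rightarrow> (('a \<Rightarrow> real) \<Rightarrow> real) \<Rightarrow> 'a set \<Rightarrow> ennreal" where
  "open_capacity M D E G =
     (INF u\<in>{u\<in>D. AE x in M. x \<in> G \<longrightarrow> u x \<ge> 1}. ennreal (E u) + sq_norm_L2 M u)"

definition quasi_continuous ::
    "'a::topological_space measure \<Rightarrow> ('a \<Rightarrow> real) set \<Rightarrow> (('a \<Rightarrow> real) \<Rightarrow> real) \<Rightarrow> ('a \<Rightarrow> real) \<Rightarrow> bool" where
  "quasi_continuous M D E u \<longleftrightarrow>
     (\<forall>e>0. \<exists>G. open G \<and> open_capacity M D E G < e \<and> continuous_on (- G) u)"

definition qc_version ::
    "'a::topological_space measure \<Rightarrow> ('a \<Rightarrow> real) set \<Rightarrow> (('a \<Rightarrow> real) \<Rightarrow> real) \<Rightarrow>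
     ('a \<Rightarrow> real) \<Rightarrow> ('a \<Rightarrow> real) \<Rightarrow> bool" where
  "qc_version M D E u v \<longleftrightarrow>
     v \<in> borel_measurable M \<and> (AE x in M. u x = v x) \<and> quasi_continuous M D E v"

definition qc_rep ::
    "'a::topological_space measure \<Rightarrow> ('a \<Rightarrow> real) set \<Rightarrow> (('a \<Rightarrow> real) \<Rightarrow> real) \<Rightarrow>
     ('a \<Rightarrow> real) \<Rightarrow> 'a \<Rightarrow> real" where
  "qc_rep M D E u = (SOME v. qc_version M D E u v)"


section \<open>Beurling--Deny decomposition\<close>

text \<open>\<open>\<Gamma> u v\<close> is a finite signed Borel measure for \<open>u, v\<close> in the domain. Strong locality (with
  bilinearity) also makes \<open>\<Gamma>\<close> invariant under almost everywhere changes of \<open>u\<close> and \<open>v\<close>.\<close>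

definition strongly_local_measure_form ::
    "'a::topological_space measure \<Rightarrow> ('a \<Rightarrow> real) set \<Rightarrow>
     (('a \<Rightarrow> real) \<Rightarrow> ('a \<Rightarrow> real) \<Rightarrow> 'a set \<Rightarrow> real) \<Rightarrow> bool" where
  "strongly_local_measure_form M D \<Gamma> \<longleftrightarrow>
     (\<forall>u\<in>D. \<forall>v\<in>D. \<forall>A::nat \<Rightarrow> 'a set. range A \<subseteq> sets borel \<and> disjoint_family A \<longrightarrow>
        (\<lambda>n. \<Gamma> u v (A n)) sums \<Gamma> u v (\<Union>n. A n)) \<and>
     (\<forall>u\<in>D. \<forall>v\<in>D. \<forall>B\<in>sets borel. \<Gamma> u v B = \<Gamma> v u B) \<and>
     (\<forall>u\<in>D. \<forall>v\<in>D. \<forall>w\<in>D. \<forall>a b. \<forall>B\<in>sets borel.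
        \<Gamma> (\<lambda>x. a * u x + b * v x) w B = a * \<Gamma> u w B + b * \<Gamma> v w B) \<and>
     (\<forall>u\<in>D. \<forall>B\<in>sets borel. \<Gamma> u u B \<ge> 0) \<and>
     (\<forall>u\<in>D. \<forall>v\<in>D. \<forall>G c. open G \<and> (AE x in M. x \<in> G \<longrightarrow> u x = c) \<longrightarrow>
        (\<forall>B\<in>sets borel. B \<subseteq> G \<longrightarrow> \<Gamma> u v B = 0))"

text \<open>\<open>J\<close> lives on the off-diagonal set \<open>- Id\<close>. As usual \<open>J\<close> is symmetric, without which it would not
  be determined by the form.\<close>

definition beurling_deny ::
    "'a::topological_space measure \<Rightarrow> ('a \<Rightarrow> real) set \<Rightarrow> (('a \<Rightarrow> real) \<Rightarrow> real) \<Rightarrow>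
     ('a \<times> 'a) measure \<Rightarrow> (('a \<Rightarrow> real) \<Rightarrow> ('a \<Rightarrow> real) \<Rightarrow> 'a set \<Rightarrow> real) \<Rightarrow> 'a measure \<Rightarrow> bool" where
  "beurling_deny M D E J \<Gamma> k \<longleftrightarrow>
     radon_measure_on (- Id) J \<and>
     (\<forall>B\<in>sets J. emeasure J (prod.swap ` B) = emeasure J B) \<and>
     strongly_local_measure_form M D \<Gamma> \<and>
     radon_measure k \<and>
     (\<forall>u\<in>D. \<forall>ut. qc_version M D E u ut \<longrightarrow>
        ennreal (E u) =
          (\<integral>\<^sup>+z. ennreal ((ut (fst z) - ut (snd z))\<^sup>2) \<partial>J)
          + ennreal (\<Gamma> u u UNIV)
          + (\<integral>\<^sup>+x. ennreal ((ut x)\<^sup>2) \<partial>k))"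


section \<open>Local domains and energy measures\<close>

definition D_loc :: "'a::topological_space measure \<Rightarrow> ('a \<Rightarrow> real) set \<Rightarrow> ('a \<Rightarrow> real) set" where
  "D_loc M D = {u \<in> L2_loc M.
     \<forall>G. open G \<and> compact (closure G) \<longrightarrow> (\<exists>v\<in>D. AE x in M. x \<in> G \<longrightarrow> u x = v x)}"

definition D_loc_star ::
    "'a::topological_space measure \<Rightarrow> ('a \<Rightarrow> real) set \<Rightarrow> (('a \<Rightarrow> real) \<Rightarrow> real) \<Rightarrow>
     ('a \<times> 'a) measure \<Rightarrow> ('a \<Rightarrow> real) set" where
  "D_loc_star M D E J = {u \<in> D_loc M D. \<forall>K. compact K \<longrightarrow>
     (\<integral>\<^sup>+z\<in>(K \<times> UNIV). ennreal ((qc_rep M D E u (fst z) - qc_rep M D E u (snd z))\<^sup>2) \<partial>J) < \<infinity>}"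

definition mu_b ::
    "'a::topological_space measure \<Rightarrow> ('a \<Rightarrow> real) set \<Rightarrow> (('a \<Rightarrow> real) \<Rightarrow> real) \<Rightarrow>
     ('a \<times> 'a) measure \<Rightarrow> ('a \<Rightarrow> real) \<Rightarrow> 'a set \<Rightarrow> ennreal" where
  "mu_b M D E J u B =
     (\<integral>\<^sup>+z\<in>(B \<times> UNIV). ennreal ((qc_rep M D E u (fst z) - qc_rep M D E u (snd z))\<^sup>2) \<partial>J)"

text \<open>The extension of \<open>u \<mapsto> \<Gamma> u u\<close> to functions that are only locally in the domain: the measure
  that agrees on every relatively compact open \<open>G\<close> with \<open>\<Gamma> v v\<close> for any \<open>v\<close> in the domain coinciding
  with \<open>u\<close> on \<open>G\<close>.\<close>

definition mu_c ::
    "'a::topological_space measure \<Rightarrow> ('a \<Rightarrow> real) set \<Rightarrow>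
     (('a \<Rightarrow> real) \<Rightarrow> ('a \<Rightarrow> real) \<Rightarrow> 'a set \<Rightarrow> real) \<Rightarrow> ('a \<Rightarrow> real) \<Rightarrow> 'a measure" where
  "mu_c M D \<Gamma> u = (THE N. sets N = sets borel \<and>
     (\<forall>G v. open G \<and> compact (closure G) \<and> v \<in> D \<and> (AE x in M. x \<in> G \<longrightarrow> u x = v x) \<longrightarrow>
        (\<forall>B\<in>sets borel. B \<subseteq> G \<longrightarrow> emeasure N B = ennreal (\<Gamma> v v B))))"


section \<open>Intrinsic metrics\<close>

definition pseudo_metric :: "('a \<Rightarrow> 'a \<Rightarrow> ennreal) \<Rightarrow> bool" where
  "pseudo_metric \<rho> \<longleftrightarrow>
     (\<forall>x. \<rho> x x = 0) \<and> (\<forall>x y. \<rho> x y = \<rho> y x) \<and> (\<forall>x y z. \<rho> x z \<le> \<rho> x y + \<rho> y z)"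

text \<open>The real-valued function \<open>\<rho>\<^sub>A \<and> T\<close>; for empty \<open>A\<close> the infimum is \<open>\<infinity>\<close>.\<close>

definition truncated_dist :: "('a \<Rightarrow> 'a \<Rightarrow> ennreal) \<Rightarrow> 'a set \<Rightarrow> real \<Rightarrow> 'a \<Rightarrow> real" where
  "truncated_dist \<rho> A T x = enn2real (min (INF y\<in>A. \<rho> x y) (ennreal T))"

text \<open>\<open>\<rho>\<close> is an intrinsic metric for the form \<open>(D, E)\<close> whose Beurling--Deny decomposition has jump
  measure \<open>J\<close>, strongly local part \<open>\<Gamma>\<close> and killing measure \<open>k\<close>.\<close>

definition intrinsic_metric ::
    "'a::topological_space measure \<Rightarrow> ('a \<Rightarrow> real) set \<Rightarrow> (('a \<Rightarrow> real) \<Rightarrow> real) \<Rightarrow>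
     ('a \<times> 'a) measure \<Rightarrow> (('a \<Rightarrow> real) \<Rightarrow> ('a \<Rightarrow> real) \<Rightarrow> 'a set \<Rightarrow> real) \<Rightarrow> 'a measure \<Rightarrow>
     ('a \<Rightarrow> 'a \<Rightarrow> ennreal) \<Rightarrow> bool" where
  "intrinsic_metric M D E J \<Gamma> k \<rho> \<longleftrightarrow>
     beurling_deny M D E J \<Gamma> k \<and>
     pseudo_metric \<rho> \<and>
     (\<exists>m\<^sub>b m\<^sub>c. radon_measure m\<^sub>b \<and> radon_measure m\<^sub>c \<and>
        (\<forall>B\<in>sets borel. emeasure m\<^sub>b B + emeasure m\<^sub>c B \<le> emeasure M B) \<and>
        (\<forall>A T. T > 0 \<longrightarrow>
           truncated_dist \<rho> A T \<in> D_loc_star M D E J \<and>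
           continuous_on UNIV (truncated_dist \<rho> A T) \<and>
           (\<forall>B\<in>sets borel. mu_b M D E J (truncated_dist \<rho> A T) B \<le> emeasure m\<^sub>b B) \<and>
           (\<forall>B\<in>sets borel. emeasure (mu_c M D \<Gamma> (truncated_dist \<rho> A T)) B \<le> emeasure m\<^sub>c B)))"


section \<open>Pure jump forms\<close>

definition jump_integral ::
    "'a measure \<Rightarrow> ('a \<Rightarrow> 'a \<Rightarrow> ennreal) \<Rightarrow> ('a \<Rightarrow> real) \<Rightarrow> ennreal" where
  "jump_integral M j u =
     (\<integral>\<^sup>+z\<in>- Id. ennreal ((u (fst z) - u (snd z))\<^sup>2) * j (fst z) (snd z) \<partial>(M \<Otimes>\<^sub>M M))"

definition jump_predomain ::
    "'a::topological_space measure \<Rightarrow> ('a \<Rightarrow> 'a \<Rightarrow> ennreal) \<Rightarrow> ('a \<Rightarrow> real) set" where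
  "jump_predomain M j = {u \<in> Cc. jump_integral M j u < \<infinity>}"

definition jump_domain ::
    "'a::topological_space measure \<Rightarrow> ('a \<Rightarrow> 'a \<Rightarrow> ennreal) \<Rightarrow> ('a \<Rightarrow> real) set" where
  "jump_domain M j = closure_domain M (jump_predomain M j) (\<lambda>u. enn2real (jump_integral M j u))"

definition jump_form ::
    "'a::topological_space measure \<Rightarrow> ('a \<Rightarrow> 'a \<Rightarrow> ennreal) \<Rightarrow> ('a \<Rightarrow> real) \<Rightarrow> real" where
  "jump_form M j = closure_form M (jump_predomain M j) (\<lambda>u. enn2real (jump_integral M j u))"

definition jump_measure ::
    "'a measure \<Rightarrow> ('a \<Rightarrow> 'a \<Rightarrow> ennreal) \<Rightarrow> ('a \<times> 'a) measure" where
  "jump_measure M j =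
     restrict_space (density (M \<Otimes>\<^sub>M M) (\<lambda>z. j (fst z) (snd z))) (- Id)"

end

theory Submission
  imports Defs
begin

text \<open>
  Write \<open>J\<close> for the measure \<open>j(x, y) M(dx) M(dy)\<close> off the diagonal and \<open>f = \<rho>\<^sub>A \<and> T\<close>.

  The triangle inequality gives \<open>\<bar>f x - f y\<bar> \<le> \<rho> x y\<close>. Integrating the square against \<open>J\<close> over
  \<open>B \<times> X\<close> and using the hypothesis on \<open>\<rho>\<close> in the inner integral yields \<open>\<mu>\<^sup>b(f)(B) \<le> M(B)\<close>
  (\<open>lipschitz_energy_le\<close>). So \<open>m\<^sub>b = M\<close> and \<open>m\<^sub>c = 0\<close> are the required measures, once it is known that \<open>f\<close>
  belongs locally to the domain. For this \<open>f\<close> is multiplied by a cutoff function \<open>\<phi>\<close> of finite energy: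
  in \<open>(f \<phi>)(x) - (f \<phi>)(y) = f(y) (\<phi>(x) - \<phi>(y)) + \<phi>(x) (f(x) - f(y))\<close> the first summand is controlled
  by \<open>T\<close> and the energy of \<open>\<phi>\<close>, the second by \<open>M\<close> of the support of \<open>\<phi>\<close>
  (\<open>lipschitz_times_cutoff\<close>). The cutoff functions are normal contractions of uniform approximations,
  which exist by the density assumption (\<open>jump_predomain_cutoff\<close>).

  It remains to see that \<open>J\<close>, \<open>0\<close> and \<open>0\<close> really form the Beurling--Deny decomposition of the closed form.
  On the closure the form is still given by the double integral: a sequence that converges in \<open>L\<^sup>2\<close>
  has a subsequence that converges almost everywhere, hence with respect to \<open>J\<close> its differences converge
  almost everywhere, and Fatou's lemma applied to the Cauchy property shows convergence in energy
  (\<open>approximates_jump_integral\<close>); this argument also proves closability. Since \<open>J\<close> is absolutely continuous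
  with respect to the product measure, the double integral does not see the choice of the
  representative, so quasi-continuous versions can be exchanged for the functions themselves.
  That \<open>J\<close> is a Radon measure follows from two facts: a cutoff function separating two disjoint compact
  sets has finite energy, which bounds \<open>J\<close> of their product, and a locally finite Borel
  measure on an open, locally compact part of a separable metric space is Radon
  (\<open>locally_finite_imp_radon_measure_on\<close>).
\<close>


section \<open>Locally finite measures are Radon\<close>

text \<open>
  The sets that can be squeezed between a closed and an open set form a \<open>\<sigma>\<close>-algebra, and it contains
  the open sets because these are \<open>F\<^sub>\<sigma>\<close> in a metric space.
\<close>

lemma finite_borel_measure_approx:
  fixes N :: "'b::metric_space measure"
  assumes "finite_measure N" and sets_N: "sets N = sets borel"
    and B: "B \<in> sets borel" and e: "e > 0"
  obtains F U where "closed F" "open U" "F \<subseteq> B" "B \<subseteq> U" "measure N (U - F) < e"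
proof -
  interpret finite_measure N by fact
  note [measurable_cong] = sets_N
  have "B \<in> sigma_sets UNIV {S. open S}"
    using B by (simp add: sets_borel)
  then have "\<forall>e>0. \<exists>F U. closed F \<and> open U \<and> F \<subseteq> B \<and> B \<subseteq> U \<and> measure N (U - F) < e"
  proof induction
    case (Basic B)
    then have "open B" by simp
    then have "fsigma_in euclidean B"
      using open_imp_fsigma_in[OF metrizable_space_euclidean] by simp
    then obtain C where C: "\<And>n::nat. closed (C n)" "\<And>n. C n \<subseteq> C (Suc n)" "\<Union> (range C) = B"
      by (auto simp: fsigma_in_ascending)
    have "(\<lambda>n. measure N (B - C n)) \<longlonglongrightarrow> measure N (\<Inter>n. B - C n)"
    proof (rule finite_Lim_measure_decseq)
      show "range (\<lambda>n. B - C n) \<subseteq> sets N"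
        using C(1) \<open>open B\<close> by (auto simp: sets_N intro!: sets.Diff)
      show "decseq (\<lambda>n. B - C n)"
        using C(2) by (auto simp: decseq_Suc_iff)
    qed
    also have "(\<Inter>n. B - C n) = {}" using C(3) by auto
    finally have lim: "(\<lambda>n. measure N (B - C n)) \<longlonglongrightarrow> 0" by simp
    show ?case
    proof (intro allI impI)
      fix e :: real assume "e > 0"
      then obtain n where "measure N (B - C n) < e"
        using order_tendstoD(2)[OF lim] by (auto simp: eventually_sequentially)
      with C \<open>open B\<close> show "\<exists>F U. closed F \<and> open U \<and> F \<subseteq> B \<and> B \<subseteq> U \<and> measure N (U - F) < e"
        by (intro exI[of _ "C n"] exI[of _ B]) auto
    qed
  next
    case Empty
    then show ?case by (auto intro!: exI[of _ "{}"])
  next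
    case (Compl B)
    show ?case
    proof (intro allI impI)
      fix e :: real assume "e > 0"
      with Compl obtain F U where FU: "closed F" "open U" "F \<subseteq> B" "B \<subseteq> U" "measure N (U - F) < e"
        by metis
      moreover have "- F - - U = U - F" by auto
      ultimately show "\<exists>F U. closed F \<and> open U \<and> F \<subseteq> UNIV - B \<and> UNIV - B \<subseteq> U \<and> measure N (U - F) < e"
        by (intro exI[of _ "- U"] exI[of _ "- F"]) (auto simp: open_Compl closed_Compl)
    qed
  next
    case (Union B)
    show ?case
    proof (intro allI impI)
      fix e :: real assume "e > 0"
      then have "(e/4) * (1/2)^i > 0" for i :: nat by simp
      then have "\<forall>i. \<exists>F U. closed F \<and> open U \<and> F \<subseteq> B i \<and> B i \<subseteq> U \<and> measure N (U - F) < (e/4) * (1/2)^i"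
        using Union.IH by blast
      then obtain F U where FU: "\<And>i. closed (F i)" "\<And>i. open (U i)" "\<And>i. F i \<subseteq> B i" "\<And>i. B i \<subseteq> U i"
          "\<And>i. measure N (U i - F i) < (e/4) * (1/2)^i"
        by metis
      have [measurable]: "F i \<in> sets borel" "U i \<in> sets borel" for i
        using FU(1,2) by auto
      define V where "V = (\<Union>i. U i)"
      define C where "C n = (\<Union>i<n. F i)" for n :: nat
      have [measurable]: "C n \<in> sets borel" "V \<in> sets borel" for n
        unfolding C_def V_def by measurable
      have sm: "summable (\<lambda>i. (e/4) * (1/2::real)^i)"
        by (intro summable_mult summable_geometric) auto
      have sm': "summable (\<lambda>i. measure N (U i - F i))"
        by (rule summable_comparison_test'[OF sm, of 0]) (use FU(5) in \<open>auto intro: less_imp_le\<close>)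
      \<comment> \<open>An infinite union of closed sets need not be closed, so half of \<open>e\<close> is kept in
        reserve for passing to the finite union \<open>C n\<close>.\<close>
      have "measure N (V - (\<Union>i. F i)) \<le> measure N (\<Union>i. U i - F i)"
        by (rule finite_measure_mono) (auto simp: V_def)
      also have "\<dots> \<le> (\<Sum>i. measure N (U i - F i))"
        by (rule finite_measure_subadditive_countably[OF _ sm']) auto
      also have "\<dots> \<le> (\<Sum>i. (e/4) * (1/2)^i)"
        by (rule suminf_le[OF _ sm' sm]) (use FU(5) in \<open>auto intro: less_imp_le\<close>)
      also have "\<dots> = e/2"
        using suminf_geometric[of "1/2::real"] by (subst suminf_mult) (auto intro!: summable_geometric)
      also have "\<dots> < e" using \<open>e > 0\<close> by simp
      finally have small: "measure N (V - (\<Union>i. F i)) < e" .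
      have "(\<lambda>n. measure N (V - C n)) \<longlonglongrightarrow> measure N (\<Inter>n. V - C n)"
      proof (rule finite_Lim_measure_decseq)
        show "range (\<lambda>n. V - C n) \<subseteq> sets N" by (auto simp: sets_N)
        show "decseq (\<lambda>n. V - C n)"
          unfolding C_def decseq_Suc_iff by (auto simp: less_Suc_eq)
      qed
      also have "(\<Inter>n. V - C n) = V - (\<Union>i. F i)"
        unfolding C_def by auto
      finally have "eventually (\<lambda>n. measure N (V - C n) < e) sequentially"
        using small by (rule order_tendstoD(2))
      then obtain n where n: "measure N (V - C n) < e"
        by (auto simp: eventually_sequentially)
      show "\<exists>F U. closed F \<and> open U \<and> F \<subseteq> \<Union> (range B) \<and> \<Union> (range B) \<subseteq> U \<and> measure N (U - F) < e"
        using FU n by (intro exI[of _ "C n"] exI[of _ V]) (auto simp: C_def V_def, blast+)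
    qed
  qed
  with e that show thesis by meson
qed

text \<open>
  Lindelof's theorem makes the local hypothesis countable. The property \<open>P\<close> lets the exhausting sets
  carry information such as finite measure; the empty set pads a finite subcover to a sequence.
\<close>

lemma relatively_compact_exhaustion:
  fixes S :: "'b::{metric_space, second_countable_topology} set"
  assumes "\<And>x. x \<in> S \<Longrightarrow> \<exists>U. open U \<and> x \<in> U \<and> compact (closure U) \<and> closure U \<subseteq> S \<and> P U"
    and "P {}"
  obtains U :: "nat \<Rightarrow> 'b set" where "\<And>n. open (U n)" "\<And>n. compact (closure (U n))"
    "\<And>n. closure (U n) \<subseteq> S" "(\<Union>n. U n) = S" "\<And>n. P (U n)"
proof -
  let ?\<F> = "insert {} {U. open U \<and> compact (closure U) \<and> closure U \<subseteq> S \<and> P U}"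
  obtain \<G> where \<G>: "\<G> \<subseteq> ?\<F>" "countable \<G>" "\<Union>\<G> = \<Union>?\<F>"
    using Lindelof[of ?\<F>] by auto
  have "\<Union>?\<F> = S"
  proof
    show "\<Union>?\<F> \<subseteq> S" using closure_subset by fastforce
    show "S \<subseteq> \<Union>?\<F>" using assms(1) by fastforce
  qed
  define U where "U = from_nat_into (insert {} \<G>)"
  have range_U: "range U = insert {} \<G>"
    unfolding U_def using \<G>(2) by (intro range_from_nat_into) auto
  have "U n \<in> ?\<F>" for n using range_U \<G>(1) by blast
  moreover have "(\<Union>n. U n) = S" using range_U \<G>(3) \<open>\<Union>?\<F> = S\<close> by simp
  ultimately show thesis
    using that[of U] \<open>P {}\<close> by (metis (mono_tags, lifting) closure_empty compact_empty empty_subsetI insertE mem_Collect_eq open_empty)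
qed

text \<open>
  On each compact piece \<open>L n\<close> of an exhaustion the measure is finite, so it is inner regular with respect to
  closed sets; these meet \<open>L n\<close> in compact sets. Letting \<open>n\<close> grow gives inner regularity of \<open>N\<close>.
\<close>

lemma locally_finite_imp_radon_measure_on:
  fixes N :: "'b::{metric_space, second_countable_topology} measure"
  assumes sets_N: "sets N = sets (restrict_space borel S)"
    and nbhd: "\<And>x. x \<in> S \<Longrightarrow> \<exists>U. open U \<and> x \<in> U \<and> compact (closure U) \<and> closure U \<subseteq> S \<and>
      emeasure N (closure U) < \<infinity>"
  shows "radon_measure_on S N"
proof -
  obtain U where U: "\<And>n::nat. open (U n)" "\<And>n. compact (closure (U n))" "\<And>n. closure (U n) \<subseteq> S"
      "(\<Union>n. U n) = S" "\<And>n. emeasure N (closure (U n)) < \<infinity>"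
    using relatively_compact_exhaustion[of S "\<lambda>U. emeasure N (closure U) < \<infinity>"] nbhd by auto
  have S: "open S" using U(1,4) by blast
  have in_N: "B \<in> sets N \<longleftrightarrow> B \<in> sets borel \<and> B \<subseteq> S" for B
    using S by (subst sets_N) (auto simp: sets_restrict_space_iff)
  have finite_compact: "emeasure N K < \<infinity>" if "compact K" "K \<subseteq> S" for K
  proof -
    obtain I where I: "finite I" "K \<subseteq> (\<Union>n\<in>I. U n)"
      using compactE_image[OF \<open>compact K\<close>, of UNIV U] U(1,4) \<open>K \<subseteq> S\<close> by auto
    have "emeasure N K \<le> emeasure N (\<Union>n\<in>I. closure (U n))"
      using I U(3) closure_subset by (intro emeasure_mono) (auto simp: in_N intro!: sets.finite_UN, blast)
    also have "\<dots> \<le> (\<Sum>n\<in>I. emeasure N (closure (U n)))"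
      using I(1) U(3) by (intro emeasure_subadditive_finite) (auto simp: in_N)
    also have "\<dots> < \<infinity>"
      using I(1) U(5) by (simp add: ennreal_sum_less_top)
    finally show ?thesis .
  qed
  define L where "L n = (\<Union>i\<le>n. closure (U i))" for n :: nat
  have L: "compact (L n)" "L n \<subseteq> S" for n
    unfolding L_def using U(2,3) by (auto intro!: compact_UN)
  have L_borel: "L n \<in> sets borel" for n using L(1) by (rule borel_compact)
  have inner: "emeasure N B \<le> (SUP K\<in>{K. compact K \<and> K \<subseteq> B}. emeasure N K)" (is "_ \<le> ?s")
    if B: "B \<in> sets N" for B
  proof -
    have B': "B \<in> sets borel" "B \<subseteq> S" using B in_N by auto
    have part: "emeasure N (B \<inter> L n) \<le> ?s" for n
    proof (rule ennreal_le_epsilon)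
      fix e :: real assume "0 < e"
      define N' where "N' = distr (restrict_space N (L n)) borel (\<lambda>x. x)"
      have L_N: "L n \<in> sets N" using L(2) L_borel in_N by auto
      have meas: "(\<lambda>x. x) \<in> restrict_space N (L n) \<rightarrow>\<^sub>M borel"
      proof (rule measurableI)
        fix A :: "'b set" assume A: "A \<in> sets borel"
        have "A \<inter> L n \<in> sets (restrict_space N (L n))"
          using A L_N L(2)[of n] L_borel by (subst sets_restrict_space_iff) (auto simp: in_N)
        then show "(\<lambda>x. x) -` A \<inter> space (restrict_space N (L n)) \<in> sets (restrict_space N (L n))"
          using L_N by (simp add: space_restrict_space2)
      qed auto
      have em: "emeasure N' A = emeasure N (A \<inter> L n)" if "A \<in> sets borel" for A
        unfolding N'_def using that meas L_N
        by (simp add: emeasure_distr space_restrict_space2 emeasure_restrict_space sets.Int_space_eq2)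
      have "finite_measure N'"
      proof
        have "emeasure N' (space N') = emeasure N (L n)"
          using em[of UNIV] by (simp add: N'_def)
        then show "emeasure N' (space N') \<noteq> \<infinity>"
          using finite_compact[OF L] by (metis less_irrefl)
      qed
      then interpret N': finite_measure N' .
      obtain F V where FV: "closed F" "open V" "F \<subseteq> B" "B \<subseteq> V" "measure N' (V - F) < e"
        using finite_borel_measure_approx[OF \<open>finite_measure N'\<close> _ B'(1) \<open>0 < e\<close>]
        by (auto simp: N'_def)
      have FL: "F \<inter> L n \<in> sets N"
        using FV(1) L(2)[of n] L_borel[of n] by (auto simp: in_N)
      have "emeasure N (B \<inter> L n) \<le> emeasure N (F \<inter> L n \<union> ((V - F) \<inter> L n))"
        using FV L(2)[of n] L_borel[of n]
        by (intro emeasure_mono) (auto simp: in_N intro!: sets.Un sets.Int sets.Diff)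
      also have "\<dots> \<le> emeasure N (F \<inter> L n) + emeasure N ((V - F) \<inter> L n)"
        using FV L(2)[of n] L_borel[of n]
        by (intro emeasure_subadditive) (auto simp: in_N intro!: sets.Int sets.Diff)
      also have "emeasure N ((V - F) \<inter> L n) = emeasure N' (V - F)"
        using FV by (subst em) auto
      also have "\<dots> \<le> ennreal e"
        using FV(5) by (simp add: N'.emeasure_eq_measure ennreal_leI)
      also have "emeasure N (F \<inter> L n) \<le> ?s"
        using FV(1,3) L(1)[of n] by (intro SUP_upper) (auto intro: closed_Int_compact)
      finally show "emeasure N (B \<inter> L n) \<le> ?s + ennreal e" by simp
    qed
    have "(\<Union>n. B \<inter> L n) = B"
    proof
      show "B \<subseteq> (\<Union>n. B \<inter> L n)"
        using B'(2) U(4) closure_subset unfolding L_def by (auto, blast)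
    qed auto
    then have "emeasure N B = (SUP n. emeasure N (B \<inter> L n))"
      using B' L(2) L_borel
      by (subst SUP_emeasure_incseq) (auto simp: in_N incseq_Suc_iff L_def le_Suc_eq)
    also have "\<dots> \<le> ?s" using part by (rule SUP_least)
    finally show ?thesis .
  qed
  have outer: "(SUP K\<in>{K. compact K \<and> K \<subseteq> B}. emeasure N K) \<le> emeasure N B" if "B \<in> sets N" for B
    using that by (intro SUP_least emeasure_mono) auto
  show ?thesis
    unfolding radon_measure_on_def using sets_N finite_compact inner outer
    by (auto intro: antisym)
qed


section \<open>Cutoff functions\<close>

lemma compact_closure_subset: "S \<subseteq> K \<Longrightarrow> compact K \<Longrightarrow> compact (closure (S::'b::t2_space set))"
  by (metis closed_closure closure_minimal compact_Int_closed compact_imp_closed inf.absorb_iff2)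

lemma locally_compact_nbhd:
  fixes x :: "'b::metric_space"
  assumes "locally_compact_space (euclidean :: 'b topology)" "open W" "x \<in> W"
  obtains U where "open U" "x \<in> U" "compact (closure U)" "closure U \<subseteq> W"
proof -
  obtain V K where VK: "open V" "compact K" "x \<in> V" "V \<subseteq> K"
    using assms(1) unfolding locally_compact_space_def by (simp, meson)
  obtain r where r: "r > 0" "cball x r \<subseteq> W"
    using assms(2,3) open_contains_cball by blast
  have "compact (closure (V \<inter> ball x r))"
    using VK(2,4) by (intro compact_closure_subset[of _ K]) auto
  moreover have "closure (V \<inter> ball x r) \<subseteq> cball x r"
    by (rule closure_minimal) auto
  ultimately show thesis
    using that[of "V \<inter> ball x r"] VK r by auto
qed

lemma locally_compact_compact_nbhd:
  fixes K :: "'b::metric_space set"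
  assumes lc: "locally_compact_space (euclidean :: 'b topology)" and "compact K" "open W" "K \<subseteq> W"
  obtains V where "open V" "K \<subseteq> V" "compact (closure V)" "closure V \<subseteq> W"
proof -
  have "\<forall>x\<in>K. \<exists>U. open U \<and> x \<in> U \<and> compact (closure U) \<and> closure U \<subseteq> W"
    using locally_compact_nbhd[OF lc \<open>open W\<close>] \<open>K \<subseteq> W\<close> by (metis subsetD)
  then obtain U where U: "\<And>x. x \<in> K \<Longrightarrow> open (U x) \<and> x \<in> U x \<and> compact (closure (U x)) \<and> closure (U x) \<subseteq> W"
    by metis
  obtain I where I: "I \<subseteq> K" "finite I" "K \<subseteq> (\<Union>x\<in>I. U x)"
    using compactE_image[OF \<open>compact K\<close>, of K U] U by blast
  have sub: "(\<Union>x\<in>I. U x) \<subseteq> (\<Union>x\<in>I. closure (U x))"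
    using closure_subset by fast
  have comp: "compact (\<Union>x\<in>I. closure (U x))"
    using I U by (intro compact_UN) auto
  have "closure (\<Union>x\<in>I. U x) \<subseteq> (\<Union>x\<in>I. closure (U x))"
    using closure_minimal[OF sub compact_imp_closed[OF comp]] .
  then have "closure (\<Union>x\<in>I. U x) \<subseteq> W" using U I(1) by blast
  then show thesis
    using that[of "\<Union>x\<in>I. U x"] I U compact_closure_subset[OF sub comp] by blast
qed

lemma Cc_borel: "u \<in> Cc \<Longrightarrow> u \<in> borel_measurable borel"
  unfolding Cc_def by (auto intro: borel_measurable_continuous_onI)

lemma compact_support_imp_Cc:
  fixes u :: "'b::t2_space \<Rightarrow> real"
  assumes "continuous_on UNIV u" "compact K" "\<And>x. x \<notin> K \<Longrightarrow> u x = 0"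
  shows "u \<in> Cc"
  using assms unfolding Cc_def by (auto intro!: compact_closure_subset[of _ K])

lemma Cc_diff:
  fixes u v :: "'b::t2_space \<Rightarrow> real"
  assumes "u \<in> Cc" "v \<in> Cc"
  shows "(\<lambda>x. u x - v x) \<in> Cc"
proof (rule compact_support_imp_Cc)
  show "continuous_on UNIV (\<lambda>x. u x - v x)"
    using assms by (auto simp: Cc_def intro!: continuous_intros)
  show "compact (closure {x. u x \<noteq> 0} \<union> closure {x. v x \<noteq> 0})"
    using assms by (auto simp: Cc_def intro!: compact_Un)
  show "u x - v x = 0" if "x \<notin> closure {x. u x \<noteq> 0} \<union> closure {x. v x \<noteq> 0}" for x
  proof -
    have "u x = 0" "v x = 0"
      using that closure_subset[of "{x. u x \<noteq> 0}"] closure_subset[of "{x. v x \<noteq> 0}"] by blast+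
    then show ?thesis by simp
  qed
qed

text \<open>
  The Urysohn function is built for a relatively compact neighbourhood \<open>V\<close> of \<open>K\<close> instead of \<open>W\<close>, which
  makes its support compact.
\<close>

lemma Cc_cutoff:
  fixes K :: "'b::metric_space set"
  assumes lc: "locally_compact_space (euclidean :: 'b topology)" and "compact K" "open W" "K \<subseteq> W"
  obtains g :: "'b \<Rightarrow> real" where "g \<in> Cc" "\<And>x. x \<in> K \<Longrightarrow> g x = 1" "\<And>x. x \<notin> W \<Longrightarrow> g x = 0"
proof -
  obtain V where V: "open V" "K \<subseteq> V" "compact (closure V)" "closure V \<subseteq> W"
    using locally_compact_compact_nbhd assms by metis
  have "normal_space (euclidean :: 'b topology)"
    by (rule metrizable_imp_normal_space[OF metrizable_space_euclidean])
  moreover have "closed K" using \<open>compact K\<close> compact_imp_closed by blast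
  ultimately obtain g where g: "continuous_map euclidean (top_of_set {0..1::real}) g"
      "g ` (- V) \<subseteq> {0}" "g ` K \<subseteq> {1}"
    using V(1,2) by (auto elim!: Urysohn_lemma[of euclidean "- V" K 0 1] simp: disjnt_def)
  have "continuous_on UNIV g"
    using g(1) by (auto simp: continuous_map_in_subtopology)
  then have "g \<in> Cc"
    using V(3) by (rule compact_support_imp_Cc) (use g(2) closure_subset[of V] in auto)
  then show thesis
    using that[of g] g(2,3) V(4) closure_subset[of V] by blast
qed


section \<open>The jump measure and its energy\<close>

text \<open>
  This elementary inequality replaces the triangle inequality for the square root of the energy:
  it survives integration in \<open>[0, \<infinity>]\<close> term by term.
\<close>

lemma square_perturbation:
  fixes a b e :: real
  assumes "e > 0"
  shows "a\<^sup>2 \<le> (1 + e) * b\<^sup>2 + (1 + 1/e) * (a - b)\<^sup>2"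
proof -
  have "0 \<le> (e * b - (a - b))\<^sup>2 / e" using assms by simp
  also have "\<dots> = (1 + e) * b\<^sup>2 + (1 + 1/e) * (a - b)\<^sup>2 - a\<^sup>2"
    using assms by (simp add: field_simps power2_eq_square)
  finally show ?thesis by simp
qed

text \<open>
  Read \<open>a n\<close> and \<open>b\<close> as the energies of \<open>s n\<close> and \<open>u\<close> and \<open>d n\<close> as that of the difference. The
  bound \<open>a n \<le> 2 * b + 3\<close>, from \<open>e = 1\<close> and \<open>d n < 1\<close>, makes the terms with the factor \<open>e\<close> uniformly small;
  then \<open>e\<close> is fixed and \<open>d\<close> takes care of the others.
\<close>

lemma convergence_from_perturbation:
  fixes a d :: "nat \<Rightarrow> real" and b :: real
  assumes upper: "\<And>n e. e > 0 \<Longrightarrow> a n \<le> (1 + e) * b + (1 + 1/e) * d n"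
    and lower: "\<And>n e. e > 0 \<Longrightarrow> b \<le> (1 + e) * a n + (1 + 1/e) * d n"
    and d: "d \<longlonglongrightarrow> 0" and nonneg: "b \<ge> 0" "\<And>n. a n \<ge> 0" "\<And>n. d n \<ge> 0"
  shows "a \<longlonglongrightarrow> b"
proof (rule LIMSEQ_I)
  fix r :: real assume "r > 0"
  define e where "e = r / (2 * (2 * b + 3))"
  have "2 * b + 3 > 0" using nonneg(1) by simp
  then have e: "e > 0" "e * (2 * b + 3) = r / 2"
    using \<open>r > 0\<close> unfolding e_def by (simp_all add: zero_less_divide_iff divide_simps)
  have "eventually (\<lambda>n. d n < 1) sequentially"
    using order_tendstoD(2)[OF d] by simp
  moreover have "(\<lambda>n. (1 + 1/e) * d n) \<longlonglongrightarrow> (1 + 1/e) * 0"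
    by (intro tendsto_mult d tendsto_const)
  then have "eventually (\<lambda>n. (1 + 1/e) * d n < r / 2) sequentially"
    by (rule order_tendstoD(2)) (use \<open>r > 0\<close> in simp)
  ultimately have "eventually (\<lambda>n. norm (a n - b) < r) sequentially"
  proof eventually_elim
    case (elim n)
    have "a n \<le> 2 * b + 3" using upper[of 1 n] elim(1) by simp
    then have "e * a n \<le> r / 2" "e * b \<le> r / 2"
      using e nonneg(1) mult_left_mono[of "a n" "2 * b + 3" e] mult_left_mono[of b "2 * b + 3" e] by auto
    moreover have "a n - b \<le> e * b + (1 + 1/e) * d n" "b - a n \<le> e * a n + (1 + 1/e) * d n"
      using upper[OF e(1), of n] lower[OF e(1), of n] by (simp_all add: algebra_simps)
    ultimately have "a n - b < r" "b - a n < r" using elim(2) by linarith+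
    then show ?case by (simp add: abs_less_iff)
  qed
  then show "\<exists>N. \<forall>n\<ge>N. norm (a n - b) < r"
    by (simp add: eventually_sequentially)
qed

locale jump_kernel =
  fixes M :: "'a::{metric_space, second_countable_topology} measure"
    and j :: "'a \<Rightarrow> 'a \<Rightarrow> ennreal"
  assumes locally_compact: "locally_compact_space (euclidean :: 'a topology)"
    and radon: "radon_measure M"
    and kernel_measurable: "(\<lambda>z. j (fst z) (snd z)) \<in> borel_measurable (borel :: ('a \<times> 'a) measure)"
    and kernel_symmetric: "j x y = j y x"
    and predomain_dense: "f \<in> Cc \<Longrightarrow> e > 0 \<Longrightarrow> \<exists>u\<in>jump_predomain M j. \<forall>x. \<bar>f x - u x\<bar> < e"
begin

lemma sets_M [simp, measurable_cong]: "sets M = sets borel"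
  using radon unfolding radon_measure_on_def by simp

lemma space_M [simp]: "space M = UNIV"
  using sets_eq_imp_space_eq[OF sets_M] by simp

lemma continuous_measurable: "continuous_on UNIV f \<Longrightarrow> f \<in> borel_measurable M"
  using borel_measurable_continuous_onI by (simp add: measurable_cong_sets[OF sets_M refl])

lemma finite_on_compact: "compact K \<Longrightarrow> emeasure M K < \<infinity>"
  using radon unfolding radon_measure_on_def by simp

lemma exhaustion:
  obtains U :: "nat \<Rightarrow> 'a set" where "\<And>n. open (U n)" "\<And>n. compact (closure (U n))" "(\<Union>n. U n) = UNIV"
proof -
  have "\<exists>U. open U \<and> x \<in> U \<and> compact (closure U) \<and> closure U \<subseteq> UNIV \<and> True" for x :: 'a
    using locally_compact_nbhd[OF locally_compact, of UNIV x] by auto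
  then show thesis
    using relatively_compact_exhaustion[of "UNIV :: 'a set" "\<lambda>_. True"] that by metis
qed

sublocale pair_sigma_finite M M
proof -
  have "sigma_finite_measure M"
  proof
    obtain U :: "nat \<Rightarrow> 'a set" where U: "\<And>n. open (U n)" "\<And>n. compact (closure (U n))" "(\<Union>n. U n) = UNIV"
      using exhaustion by metis
    have "emeasure M (U n) \<noteq> \<infinity>" for n
      using emeasure_mono[OF closure_subset[of "U n"], of M] finite_on_compact[OF U(2)[of n]] by auto
    then show "\<exists>A. countable A \<and> A \<subseteq> sets M \<and> \<Union> A = space M \<and> (\<forall>a\<in>A. emeasure M a \<noteq> \<infinity>)"
      using U by (intro exI[of _ "range U"]) auto
  qed
  then show "pair_sigma_finite M M" unfolding pair_sigma_finite_def by simp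
qed

lemma sets_MM: "sets (M \<Otimes>\<^sub>M M) = sets borel"
proof -
  have "sets (M \<Otimes>\<^sub>M M) = sets ((borel :: 'a measure) \<Otimes>\<^sub>M (borel :: 'a measure))"
    by (rule sets_pair_measure_cong) (rule sets_M)+
  also have "\<dots> = sets borel" by (subst borel_prod) (rule refl)
  finally show ?thesis .
qed

lemma kernel_measurable_MM [measurable]:
  "(\<lambda>z. j (fst z) (snd z)) \<in> borel_measurable (M \<Otimes>\<^sub>M M)"
  using kernel_measurable measurable_cong_sets[OF sets_MM refl] by blast

lemma open_off_diagonal: "open (- Id :: ('a \<times> 'a) set)"
proof -
  have "(- Id :: ('a \<times> 'a) set) = {(x, y) | x y. x \<noteq> y}" by auto
  then show ?thesis using open_diagonal_complement by simp
qed

lemma off_diagonal_measurable [measurable]: "(- Id :: ('a \<times> 'a) set) \<in> sets (M \<Otimes>\<^sub>M M)"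
  using borel_open[OF open_off_diagonal] unfolding sets_MM .

lemma sets_jump_measure: "sets (jump_measure M j) = sets (restrict_space borel (- Id))"
  unfolding jump_measure_def by (rule sets_restrict_space_cong) (simp only: sets_density sets_MM)

lemma nn_integral_jump_measure:
  assumes [measurable]: "g \<in> borel_measurable (M \<Otimes>\<^sub>M M)"
  shows "(\<integral>\<^sup>+z. g z \<partial>jump_measure M j) =
    (\<integral>\<^sup>+z. g z * j (fst z) (snd z) * indicator (- Id) z \<partial>(M \<Otimes>\<^sub>M M))"
proof -
  have "- Id \<inter> space (M \<Otimes>\<^sub>M M) \<in> sets (M \<Otimes>\<^sub>M M)"
    by (rule sets.Int[OF off_diagonal_measurable sets.top])
  then have "(\<integral>\<^sup>+z. g z \<partial>jump_measure M j) =
      (\<integral>\<^sup>+z. g z * indicator (- Id) z \<partial>density (M \<Otimes>\<^sub>M M) (\<lambda>z. j (fst z) (snd z)))"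
    unfolding jump_measure_def
    by (intro nn_integral_restrict_space) (simp only: sets_density space_density)
  also have "\<dots> = (\<integral>\<^sup>+z. j (fst z) (snd z) * (g z * indicator (- Id) z) \<partial>(M \<Otimes>\<^sub>M M))"
    by (rule nn_integral_density; measurable)
  finally show ?thesis by (simp add: mult_ac)
qed

lemma emeasure_jump_measure:
  assumes "B \<in> sets (jump_measure M j)"
  shows "emeasure (jump_measure M j) B =
    (\<integral>\<^sup>+z. indicator B z * j (fst z) (snd z) * indicator (- Id) z \<partial>(M \<Otimes>\<^sub>M M))"
proof -
  have "B \<in> sets borel"
    using assms open_off_diagonal by (auto simp: sets_jump_measure sets_restrict_space)
  then have [measurable]: "B \<in> sets (M \<Otimes>\<^sub>M M)" unfolding sets_MM .
  show ?thesis
    unfolding nn_integral_indicator[OF assms, symmetric]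
    by (rule nn_integral_jump_measure) measurable
qed

text \<open>
  The jump measure is absolutely continuous with respect to the product measure, in which \<open>N \<times> X\<close> and
  \<open>X \<times> N\<close> are null whenever \<open>N\<close> is.
\<close>

lemma AE_jump_measure:
  assumes "AE x in M. P x"
  shows "AE z in jump_measure M j. P (fst z) \<and> P (snd z)"
proof -
  obtain N where N: "N \<in> null_sets M" "{x. \<not> P x} \<subseteq> N"
    using AE_E[OF assms] by (auto simp: null_sets_def)
  have "N \<times> UNIV \<union> UNIV \<times> N \<in> null_sets (M \<Otimes>\<^sub>M M)"
    using N(1) M1.times_in_null_sets1[of N M UNIV] M1.times_in_null_sets2[of UNIV M N] by auto
  then have "AE z in M \<Otimes>\<^sub>M M. P (fst z) \<and> P (snd z)"
    by (rule AE_I'[of _ _ ]) (use N(2) in auto)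
  moreover have "- Id \<inter> space (M \<Otimes>\<^sub>M M) \<in> sets (M \<Otimes>\<^sub>M M)"
    by (rule sets.Int[OF off_diagonal_measurable sets.top])
  ultimately show ?thesis
    unfolding jump_measure_def
    by (subst AE_restrict_space_iff) (auto simp only: sets_density space_density AE_density[OF kernel_measurable_MM] elim!: AE_mp)
qed

lemma measurable_jump_measure:
  assumes "g \<in> M \<Otimes>\<^sub>M M \<rightarrow>\<^sub>M L"
  shows "g \<in> jump_measure M j \<rightarrow>\<^sub>M L"
  unfolding jump_measure_def
  by (rule measurable_restrict_space1) (use assms in simp)

lemma fst_jump_measure [measurable]: "fst \<in> jump_measure M j \<rightarrow>\<^sub>M M"
  and snd_jump_measure [measurable]: "snd \<in> jump_measure M j \<rightarrow>\<^sub>M M"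
  by (rule measurable_jump_measure; measurable)+

lemma jump_integral_eq:
  assumes [measurable]: "u \<in> borel_measurable M"
  shows "jump_integral M j u = (\<integral>\<^sup>+z. ennreal ((u (fst z) - u (snd z))\<^sup>2) \<partial>jump_measure M j)"
  unfolding jump_integral_def by (subst nn_integral_jump_measure) auto

lemma jump_integral_cong_AE:
  assumes "u \<in> borel_measurable M" "v \<in> borel_measurable M" "AE x in M. u x = v x"
  shows "jump_integral M j u = jump_integral M j v"
  unfolding jump_integral_eq[OF assms(1)] jump_integral_eq[OF assms(2)]
  by (rule nn_integral_cong_AE) (use AE_jump_measure[OF assms(3)] in \<open>auto elim!: AE_mp\<close>)

lemma jump_integral_perturbation:
  assumes [measurable]: "u \<in> borel_measurable M" "v \<in> borel_measurable M" and "e > 0"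
  shows "jump_integral M j u \<le>
    ennreal (1 + e) * jump_integral M j v + ennreal (1 + 1/e) * jump_integral M j (\<lambda>x. u x - v x)"
proof -
  have "jump_integral M j u \<le> (\<integral>\<^sup>+z. ennreal (1 + e) * ennreal ((v (fst z) - v (snd z))\<^sup>2) +
      ennreal (1 + 1/e) * ennreal ((u (fst z) - v (fst z) - (u (snd z) - v (snd z)))\<^sup>2) \<partial>jump_measure M j)"
    unfolding jump_integral_eq[OF assms(1)]
  proof (rule nn_integral_mono)
    fix z
    have "(u (fst z) - u (snd z))\<^sup>2 \<le> (1 + e) * (v (fst z) - v (snd z))\<^sup>2 +
        (1 + 1/e) * (u (fst z) - v (fst z) - (u (snd z) - v (snd z)))\<^sup>2"
      using square_perturbation[OF \<open>e > 0\<close>, of "u (fst z) - u (snd z)" "v (fst z) - v (snd z)"]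
      by (simp add: algebra_simps)
    then have "ennreal ((u (fst z) - u (snd z))\<^sup>2) \<le> ennreal ((1 + e) * (v (fst z) - v (snd z))\<^sup>2 +
        (1 + 1/e) * (u (fst z) - v (fst z) - (u (snd z) - v (snd z)))\<^sup>2)"
      by (rule ennreal_leI)
    also have "\<dots> = ennreal (1 + e) * ennreal ((v (fst z) - v (snd z))\<^sup>2) +
      ennreal (1 + 1/e) * ennreal ((u (fst z) - v (fst z) - (u (snd z) - v (snd z)))\<^sup>2)"
      using \<open>e > 0\<close> by (subst ennreal_plus) (auto simp: ennreal_mult)
    finally show "ennreal ((u (fst z) - u (snd z))\<^sup>2) \<le> \<dots>" .
  qed
  also have "\<dots> = ennreal (1 + e) * jump_integral M j v + ennreal (1 + 1/e) * jump_integral M j (\<lambda>x. u x - v x)"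
    by (simp add: nn_integral_add nn_integral_cmult jump_integral_eq)
  finally show ?thesis .
qed

lemma jump_integral_minus_commute:
  "jump_integral M j (\<lambda>x. u x - v x) = jump_integral M j (\<lambda>x. v x - u x)"
proof -
  have "(u x - v x - (u y - v y))\<^sup>2 = (v x - u x - (v y - u y))\<^sup>2" for x y
    by (simp add: power2_commute[of "u x - v x"] algebra_simps power2_eq_square)
  then show ?thesis unfolding jump_integral_def by simp
qed

lemma jump_integral_Fatou:
  assumes [measurable]: "\<And>n. s n \<in> borel_measurable M" "u \<in> borel_measurable M"
    and lim: "AE x in M. (\<lambda>n. s n x) \<longlonglongrightarrow> u x"
  shows "jump_integral M j u \<le> liminf (\<lambda>n. jump_integral M j (s n))"
proof -
  have "AE z in jump_measure M j. ennreal ((u (fst z) - u (snd z))\<^sup>2) =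
      liminf (\<lambda>n. ennreal ((s n (fst z) - s n (snd z))\<^sup>2))"
    using AE_jump_measure[OF lim]
  proof eventually_elim
    case (elim z)
    then have "(\<lambda>n. ennreal ((s n (fst z) - s n (snd z))\<^sup>2)) \<longlonglongrightarrow> ennreal ((u (fst z) - u (snd z))\<^sup>2)"
      by (intro tendsto_ennrealI tendsto_power tendsto_diff) auto
    then show ?case by (intro lim_imp_Liminf[symmetric]) auto
  qed
  then have "jump_integral M j u =
      (\<integral>\<^sup>+z. liminf (\<lambda>n. ennreal ((s n (fst z) - s n (snd z))\<^sup>2)) \<partial>jump_measure M j)"
    by (subst jump_integral_eq) (auto intro: nn_integral_cong_AE)
  also have "\<dots> \<le> liminf (\<lambda>n. \<integral>\<^sup>+z. ennreal ((s n (fst z) - s n (snd z))\<^sup>2) \<partial>jump_measure M j)"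
    by (rule nn_integral_liminf) measurable
  finally show ?thesis by (simp add: jump_integral_eq)
qed

lemma Cc_imp_L2:
  assumes "u \<in> Cc"
  shows "u \<in> L2 M"
proof -
  let ?K = "closure {x. u x \<noteq> 0}"
  have u: "continuous_on UNIV u" "compact ?K" using assms by (auto simp: Cc_def)
  have [measurable]: "u \<in> borel_measurable M" using Cc_borel[OF assms] by (simp add: measurable_cong_sets[OF sets_M refl])
  have "compact (u ` ?K)"
    using u continuous_on_subset by (intro compact_continuous_image) auto
  then obtain C where C: "\<And>x. x \<in> ?K \<Longrightarrow> \<bar>u x\<bar> \<le> C"
    using compact_imp_bounded bounded_iff by (metis image_eqI real_norm_def)
  have "(u x)\<^sup>2 \<le> C\<^sup>2 * indicator ?K x" for x
  proof (cases "x \<in> ?K")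
    case True
    then show ?thesis using power_mono[OF C[OF True] abs_ge_zero, of 2] by simp
  next
    case False
    then show ?thesis using closure_subset[of "{x. u x \<noteq> 0}"] by (auto simp: indicator_def)
  qed
  then have "sq_norm_L2 M u \<le> (\<integral>\<^sup>+x. ennreal (C\<^sup>2 * indicator ?K x) \<partial>M)"
    unfolding sq_norm_L2_def by (intro nn_integral_mono ennreal_leI)
  also have "\<dots> = ennreal (C\<^sup>2) * emeasure M ?K"
    by (simp add: ennreal_mult ennreal_indicator nn_integral_cmult_indicator)
  also have "\<dots> < \<infinity>" using finite_on_compact[OF u(2)] by (simp add: ennreal_mult_less_top)
  finally show ?thesis unfolding L2_def by simp
qed

lemma predomain_measurable: "u \<in> jump_predomain M j \<Longrightarrow> u \<in> borel_measurable M"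
  unfolding jump_predomain_def using Cc_borel by (auto simp: measurable_cong_sets[OF sets_M refl])

lemma predomain_diff:
  assumes "u \<in> jump_predomain M j" "v \<in> jump_predomain M j"
  shows "(\<lambda>x. u x - v x) \<in> jump_predomain M j"
proof -
  note [measurable] = assms[THEN predomain_measurable]
  \<comment> \<open>With \<open>w = u - v\<close> and \<open>e = 1\<close>: the energy of \<open>w\<close> is at most twice that of \<open>u\<close> plus twice that of \<open>w - u = - v\<close>.\<close>
  have "jump_integral M j (\<lambda>x. u x - v x) \<le>
      ennreal 2 * jump_integral M j u + ennreal 2 * jump_integral M j (\<lambda>x. u x - v x - u x)"
    using jump_integral_perturbation[of "\<lambda>x. u x - v x" u 1] by simp
  also have "jump_integral M j (\<lambda>x. u x - v x - u x) = jump_integral M j v"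
    by (simp add: jump_integral_def power2_commute)
  also have "ennreal 2 * jump_integral M j u + ennreal 2 * jump_integral M j v < \<infinity>"
    using assms by (simp add: jump_predomain_def ennreal_mult_less_top)
  finally show ?thesis using assms by (simp add: jump_predomain_def Cc_diff)
qed

text \<open>
  In \<open>L\<^sup>2\<close> convergence means that the squared differences tend to zero in \<open>L\<^sup>1\<close>, hence almost
  everywhere along a subsequence.
\<close>

lemma approximates_subseq:
  assumes appr: "approximates M (jump_predomain M j) E s u" and u: "u \<in> L2 M"
  obtains r where "strict_mono r" "AE x in M. (\<lambda>n. s (r n) x) \<longlonglongrightarrow> u x"
proof -
  have s: "\<And>n. s n \<in> jump_predomain M j" and lim: "(\<lambda>n. sq_norm_L2 M (\<lambda>x. s n x - u x)) \<longlonglongrightarrow> 0"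
    using appr by (auto simp: approximates_def)
  have [measurable]: "s n \<in> borel_measurable M" "u \<in> borel_measurable M" for n
    using predomain_measurable[OF s] u by (auto simp: L2_def)
  have fin: "sq_norm_L2 M (\<lambda>x. s n x - u x) < \<infinity>" for n
  proof -
    have "s n \<in> L2 M" using s[of n] by (auto simp: jump_predomain_def intro: Cc_imp_L2)
    then have "ennreal 2 * sq_norm_L2 M (s n) + ennreal 2 * sq_norm_L2 M u < \<infinity>"
      using u by (simp add: L2_def ennreal_mult_less_top)
    moreover have "sq_norm_L2 M (\<lambda>x. s n x - u x) \<le> (\<integral>\<^sup>+x. ennreal 2 * ennreal ((s n x)\<^sup>2) + ennreal 2 * ennreal ((u x)\<^sup>2) \<partial>M)"
      unfolding sq_norm_L2_def
    proof (rule nn_integral_mono)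
      fix x
      have "(s n x - u x)\<^sup>2 \<le> 2 * (s n x)\<^sup>2 + 2 * (u x)\<^sup>2"
        using square_perturbation[of 1 "s n x - u x" "s n x"] by simp
      then have "ennreal ((s n x - u x)\<^sup>2) \<le> ennreal (2 * (s n x)\<^sup>2 + 2 * (u x)\<^sup>2)"
        by (rule ennreal_leI)
      then show "ennreal ((s n x - u x)\<^sup>2) \<le> ennreal 2 * ennreal ((s n x)\<^sup>2) + ennreal 2 * ennreal ((u x)\<^sup>2)"
        by (simp add: ennreal_mult)
    qed
    moreover have "\<dots> = ennreal 2 * sq_norm_L2 M (s n) + ennreal 2 * sq_norm_L2 M u"
      unfolding sq_norm_L2_def by (subst nn_integral_add) (auto simp: nn_integral_cmult)
    ultimately show ?thesis by (metis le_less_trans)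
  qed
  have int: "integrable M (\<lambda>x. (s n x - u x)\<^sup>2)" for n
    using fin[of n] by (intro integrableI_bounded) (auto simp: sq_norm_L2_def)
  have "(\<integral>x. norm ((s n x - u x)\<^sup>2) \<partial>M) = enn2real (sq_norm_L2 M (\<lambda>x. s n x - u x))" for n
    unfolding sq_norm_L2_def by (subst integral_eq_nn_integral) auto
  moreover have "(\<lambda>n. enn2real (sq_norm_L2 M (\<lambda>x. s n x - u x))) \<longlonglongrightarrow> 0"
    using lim by (intro tendsto_enn2real) auto
  ultimately have "(\<lambda>n. \<integral>x. norm ((s n x - u x)\<^sup>2) \<partial>M) \<longlonglongrightarrow> 0" by simp
  then obtain r :: "nat \<Rightarrow> nat" where r: "strict_mono r" "AE x in M. (\<lambda>n. (s (r n) x - u x)\<^sup>2) \<longlonglongrightarrow> 0"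
    using tendsto_L1_AE_subseq[where u = "\<lambda>n x. (s n x - u x)\<^sup>2", OF int] by blast
  from r(2) have "AE x in M. (\<lambda>n. s (r n) x) \<longlonglongrightarrow> u x"
  proof eventually_elim
    case (elim x)
    then have "(\<lambda>n. sqrt ((s (r n) x - u x)\<^sup>2)) \<longlonglongrightarrow> sqrt 0" by (rule tendsto_real_sqrt)
    then have "(\<lambda>n. s (r n) x - u x) \<longlonglongrightarrow> 0" by (simp add: tendsto_rabs_zero_iff)
    then show ?case by (simp add: LIM_zero_iff)
  qed
  then show thesis using r(1) that by blast
qed

text \<open>
  For fixed \<open>k\<close>, Fatou's lemma along the subsequence bounds the energy of \<open>s k - u\<close> by the limit inferior over \<open>n\<close> of the
  energies of \<open>s k - s (r n)\<close>, and these are small by the Cauchy property. So \<open>s\<close> converges to \<open>u\<close> in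
  energy.
\<close>

lemma approximates_jump_integral:
  assumes appr: "approximates M (jump_predomain M j) (\<lambda>u. enn2real (jump_integral M j u)) s u"
    and u: "u \<in> L2 M"
  shows "jump_integral M j u < \<infinity>"
    and "(\<lambda>n. enn2real (jump_integral M j (s n))) \<longlonglongrightarrow> enn2real (jump_integral M j u)"
proof -
  have s: "\<And>n. s n \<in> jump_predomain M j"
    using appr by (auto simp: approximates_def)
  have [measurable]: "s n \<in> borel_measurable M" "u \<in> borel_measurable M" for n
    using predomain_measurable[OF s] u by (auto simp: L2_def)
  have fin_s: "jump_integral M j (s n) < \<infinity>" for n using s by (simp add: jump_predomain_def)
  obtain r where r: "strict_mono r" "AE x in M. (\<lambda>n. s (r n) x) \<longlonglongrightarrow> u x"
    using approximates_subseq[OF appr u] by blast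
  have small: "\<exists>N. \<forall>k\<ge>N. jump_integral M j (\<lambda>x. s k x - u x) \<le> ennreal e" if "e > 0" for e
  proof -
    obtain N where N: "\<And>k l. k \<ge> N \<Longrightarrow> l \<ge> N \<Longrightarrow> enn2real (jump_integral M j (\<lambda>x. s k x - s l x)) < e"
      using appr \<open>e > 0\<close> unfolding approximates_def by metis
    have N': "jump_integral M j (\<lambda>x. s k x - s l x) \<le> ennreal e" if "k \<ge> N" "l \<ge> N" for k l
    proof -
      have "jump_integral M j (\<lambda>x. s k x - s l x) < \<infinity>"
        using predomain_diff[OF s s] by (simp add: jump_predomain_def)
      then show ?thesis
        using N[OF that] by (metis ennreal_enn2real ennreal_leI infinity_ennreal_def less_imp_le)
    qed
    have "jump_integral M j (\<lambda>x. s k x - u x) \<le> ennreal e" if "k \<ge> N" for k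
    proof -
      have "jump_integral M j (\<lambda>x. s k x - u x) \<le> liminf (\<lambda>n. jump_integral M j (\<lambda>x. s k x - s (r n) x))"
        by (rule jump_integral_Fatou) (use r(2) in \<open>auto elim!: AE_mp intro!: tendsto_diff\<close>)
      also have "\<dots> \<le> ennreal e"
      proof (rule Liminf_le)
        show "\<forall>\<^sub>F n in sequentially. jump_integral M j (\<lambda>x. s k x - s (r n) x) \<le> ennreal e"
          using N'[OF that] strict_mono_imp_increasing[OF r(1)] 
          by (auto simp: eventually_sequentially intro!: exI[of _ N] intro: order_trans)
      qed simp
      finally show ?thesis .
    qed
    then show ?thesis by blast
  qed
  obtain N1 where N1: "\<And>k. k \<ge> N1 \<Longrightarrow> jump_integral M j (\<lambda>x. s k x - u x) \<le> ennreal 1"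
    using small[of 1] by auto
  have "jump_integral M j u \<le> ennreal (1 + 1) * jump_integral M j (s N1) +
      ennreal (1 + 1/1) * jump_integral M j (\<lambda>x. u x - s N1 x)"
    by (rule jump_integral_perturbation) auto
  also have "\<dots> < \<infinity>"
    using fin_s[of N1] N1[of N1] jump_integral_minus_commute[of u "s N1"]
    by (auto simp: ennreal_mult_less_top intro: le_less_trans)
  finally show fin_u: "jump_integral M j u < \<infinity>" .
  let ?d = "\<lambda>n. enn2real (jump_integral M j (\<lambda>x. s n x - u x))"
  have fin_d: "jump_integral M j (\<lambda>x. s n x - u x) < \<infinity>" for n
  proof -
    \<comment> \<open>Perturbing \<open>s n - u\<close> to \<open>s n\<close> leaves the difference \<open>- u\<close>.\<close>
    have "jump_integral M j (\<lambda>x. s n x - u x) \<le> ennreal (1 + 1) * jump_integral M j (s n) +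
      ennreal (1 + 1/1) * jump_integral M j (\<lambda>x. s n x - u x - s n x)"
      by (rule jump_integral_perturbation) auto
    also have "jump_integral M j (\<lambda>x. s n x - u x - s n x) = jump_integral M j u"
      by (simp add: jump_integral_def power2_commute)
    also have "ennreal (1 + 1) * jump_integral M j (s n) + ennreal (1 + 1/1) * jump_integral M j u < \<infinity>"
      using fin_s[of n] fin_u by (simp add: ennreal_mult_less_top)
    finally show ?thesis .
  qed
  have real_perturbation: "enn2real (jump_integral M j v) \<le>
      (1 + e) * enn2real (jump_integral M j w) + (1 + 1/e) * enn2real (jump_integral M j (\<lambda>x. v x - w x))"
    if [measurable]: "v \<in> borel_measurable M" "w \<in> borel_measurable M" and "e > 0"
      and fin: "jump_integral M j w < \<infinity>" "jump_integral M j (\<lambda>x. v x - w x) < \<infinity>" for v w e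
  proof -
    let ?R = "(1 + e) * enn2real (jump_integral M j w) + (1 + 1/e) * enn2real (jump_integral M j (\<lambda>x. v x - w x))"
    have "jump_integral M j v \<le> ennreal (1 + e) * ennreal (enn2real (jump_integral M j w)) +
        ennreal (1 + 1/e) * ennreal (enn2real (jump_integral M j (\<lambda>x. v x - w x)))"
      using jump_integral_perturbation[of v w e] that by simp
    also have "\<dots> = ennreal ?R"
      using \<open>e > 0\<close> by (subst ennreal_plus) (auto simp: ennreal_mult)
    finally show ?thesis
      using \<open>e > 0\<close> by (intro enn2real_leI) auto
  qed
  show "(\<lambda>n. enn2real (jump_integral M j (s n))) \<longlonglongrightarrow> enn2real (jump_integral M j u)"
  proof (rule convergence_from_perturbation[where d = ?d])
    show "?d \<longlonglongrightarrow> 0"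
    proof (rule LIMSEQ_I)
      fix e :: real assume "e > 0"
      then obtain N where N: "\<And>k. k \<ge> N \<Longrightarrow> jump_integral M j (\<lambda>x. s k x - u x) \<le> ennreal (e/2)"
        using small[of "e/2"] by auto
      then have "?d k \<le> e/2" if "k \<ge> N" for k
        using that \<open>e > 0\<close> by (intro enn2real_leI) auto
      then show "\<exists>N. \<forall>k\<ge>N. norm (?d k - 0) < e"
        using \<open>e > 0\<close> by (intro exI[of _ N]) force
    qed
  next
    fix n and e :: real assume "e > 0"
    show "enn2real (jump_integral M j (s n)) \<le> (1 + e) * enn2real (jump_integral M j u) + (1 + 1/e) * ?d n"
      using \<open>e > 0\<close> fin_u fin_d by (intro real_perturbation) auto
    show "enn2real (jump_integral M j u) \<le> (1 + e) * enn2real (jump_integral M j (s n)) + (1 + 1/e) * ?d n"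
      using real_perturbation[of u "s n" e] \<open>e > 0\<close> fin_s[of n] fin_d[of n]
        jump_integral_minus_commute[of u "s n"] by simp
  qed auto
qed

text \<open>
  The energy of an approximating sequence converges to the jump integral of \<open>u\<close> whichever sequence is chosen, so the
  double integral remains valid on the whole closure.
\<close>

lemma jump_form_eq:
  assumes "u \<in> jump_domain M j"
  shows "ennreal (jump_form M j u) = jump_integral M j u"
proof -
  let ?E = "\<lambda>u. enn2real (jump_integral M j u)"
  let ?s = "SOME s. approximates M (jump_predomain M j) ?E s u"
  have u: "u \<in> L2 M" and "\<exists>s. approximates M (jump_predomain M j) ?E s u"
    using assms unfolding jump_domain_def closure_domain_def by auto
  from this(2) have "approximates M (jump_predomain M j) ?E ?s u" by (rule someI_ex)
  from approximates_jump_integral[OF this u] show ?thesis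
    unfolding jump_form_def closure_form_def by (simp add: limI)
qed

lemma jump_domain_measurable: "u \<in> jump_domain M j \<Longrightarrow> u \<in> borel_measurable M"
  unfolding jump_domain_def closure_domain_def L2_def by simp

lemma predomain_subset_domain: "jump_predomain M j \<subseteq> jump_domain M j"
proof
  fix u assume u: "u \<in> jump_predomain M j"
  then have "u \<in> L2 M" by (auto simp: jump_predomain_def intro: Cc_imp_L2)
  moreover have "approximates M (jump_predomain M j) (\<lambda>u. enn2real (jump_integral M j u)) (\<lambda>n. u) u"
    using u unfolding approximates_def by (simp add: jump_integral_def sq_norm_L2_def)
  ultimately show "u \<in> jump_domain M j"
    unfolding jump_domain_def closure_domain_def by blast
qed

text \<open>
  A function \<open>u\<close> of finite energy within \<open>1/3\<close> of a continuous cutoff function \<open>g\<close> exceeds \<open>2/3\<close> on \<open>K\<close> and stays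
  below \<open>1/3\<close> where \<open>g\<close> vanishes. Clamping \<open>3 * u - 1\<close> to the unit interval turns this into exact values and
  multiplies the energy by at most \<open>9\<close>.
\<close>

lemma jump_predomain_cutoff:
  assumes "compact K" "open W" "K \<subseteq> W"
  obtains \<phi> where "\<phi> \<in> jump_predomain M j" "\<And>x. 0 \<le> \<phi> x" "\<And>x. \<phi> x \<le> 1"
    "\<And>x. x \<in> K \<Longrightarrow> \<phi> x = 1" "\<And>x. x \<notin> W \<Longrightarrow> \<phi> x = 0"
proof -
  obtain V where V: "open V" "K \<subseteq> V" "compact (closure V)" "closure V \<subseteq> W"
    using locally_compact_compact_nbhd[OF locally_compact assms] by metis
  obtain g where g: "g \<in> Cc" "\<And>x. x \<in> K \<Longrightarrow> g x = 1" "\<And>x. x \<notin> V \<Longrightarrow> g x = 0"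
    using Cc_cutoff[OF locally_compact assms(1) V(1,2)] by metis
  obtain u where u: "u \<in> jump_predomain M j" "\<And>x. \<bar>g x - u x\<bar> < 1/3"
    using predomain_dense[OF g(1), of "1/3"] by auto
  define \<phi> where "\<phi> x = max 0 (min 1 (3 * u x - 1))" for x
  have \<phi>_V: "\<phi> x = 0" if "x \<notin> V" for x
    using u(2)[of x] g(3)[OF that] by (simp add: \<phi>_def)
  have "continuous_on UNIV u" using u(1) by (simp add: jump_predomain_def Cc_def)
  then have "continuous_on UNIV \<phi>"
    unfolding \<phi>_def by (intro continuous_intros)
  then have "\<phi> \<in> Cc"
    using V(3) by (rule compact_support_imp_Cc) (use \<phi>_V closure_subset[of V] in blast)
  moreover have "jump_integral M j \<phi> < \<infinity>"
  proof -
    note [measurable] = predomain_measurable[OF u(1)]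
    have [measurable]: "\<phi> \<in> borel_measurable M" unfolding \<phi>_def by measurable
    have "jump_integral M j \<phi> \<le> (\<integral>\<^sup>+z. 9 * ennreal ((u (fst z) - u (snd z))\<^sup>2) \<partial>jump_measure M j)"
    proof (subst jump_integral_eq, measurable, rule nn_integral_mono)
      fix z
      have "\<bar>\<phi> (fst z) - \<phi> (snd z)\<bar> \<le> 3 * \<bar>u (fst z) - u (snd z)\<bar>"
        unfolding \<phi>_def by (auto simp: max_def min_def abs_if)
      then have "(\<phi> (fst z) - \<phi> (snd z))\<^sup>2 \<le> (3 * \<bar>u (fst z) - u (snd z)\<bar>)\<^sup>2"
        by (metis abs_ge_zero power2_abs power_mono)
      then have "ennreal ((\<phi> (fst z) - \<phi> (snd z))\<^sup>2) \<le> ennreal (9 * (u (fst z) - u (snd z))\<^sup>2)"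
        by (intro ennreal_leI) (simp add: power_mult_distrib)
      then show "ennreal ((\<phi> (fst z) - \<phi> (snd z))\<^sup>2) \<le> 9 * ennreal ((u (fst z) - u (snd z))\<^sup>2)"
        by (simp add: ennreal_mult)
    qed
    also have "\<dots> = 9 * jump_integral M j u"
      by (simp add: nn_integral_cmult jump_integral_eq)
    also have "\<dots> < \<infinity>"
      using u(1) by (simp add: jump_predomain_def ennreal_mult_less_top)
    finally show ?thesis .
  qed
  ultimately have "\<phi> \<in> jump_predomain M j" by (simp add: jump_predomain_def)
  moreover have "\<phi> x = 1" if "x \<in> K" for x
    using u(2)[of x] g(2)[OF that] unfolding \<phi>_def by (simp add: max_def min_def abs_if split: if_splits)
  moreover have "\<phi> x = 0" if "x \<notin> W" for x
    using \<phi>_V V(4) closure_subset[of V] that by blast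
  ultimately show thesis using that[of \<phi>] by (simp add: \<phi>_def)
qed

text \<open>
  Local finiteness: if \<open>\<phi>\<close> is \<open>1\<close> on one compact set and \<open>0\<close> on another, the integrand of its energy is \<open>1\<close>
  on their product, so \<open>J\<close> of the product is at most the energy of \<open>\<phi>\<close>.
\<close>

lemma radon_jump_measure: "radon_measure_on (- Id) (jump_measure M j)"
proof (rule locally_finite_imp_radon_measure_on[OF sets_jump_measure])
  fix z :: "'a \<times> 'a" assume "z \<in> - Id"
  then obtain x y where z: "z = (x, y)" "x \<noteq> y" by (cases z) auto
  obtain A B where AB: "open A" "open B" "x \<in> A" "y \<in> B" "A \<inter> B = {}"
    using hausdorff[OF z(2)] by auto
  obtain U where U: "open U" "x \<in> U" "compact (closure U)" "closure U \<subseteq> A"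
    using locally_compact_nbhd[OF locally_compact AB(1,3)] by metis
  obtain V where V: "open V" "y \<in> V" "compact (closure V)" "closure V \<subseteq> B"
    using locally_compact_nbhd[OF locally_compact AB(2,4)] by metis
  obtain \<phi> where \<phi>: "\<phi> \<in> jump_predomain M j" "\<And>x. x \<in> closure U \<Longrightarrow> \<phi> x = 1" "\<And>x. x \<notin> A \<Longrightarrow> \<phi> x = 0"
    using jump_predomain_cutoff[OF U(3) AB(1) U(4)] by metis
  note [measurable] = predomain_measurable[OF \<phi>(1)]
  have off: "closure U \<times> closure V \<subseteq> - Id" using AB(5) U(4) V(4) by auto
  have "closure U \<times> closure V \<in> sets borel"
    by (intro borel_closed closed_Times closed_closure)
  then have meas: "closure U \<times> closure V \<in> sets (jump_measure M j)"
    using off borel_open[OF open_off_diagonal] unfolding sets_jump_measure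
    by (subst sets_restrict_space_iff) auto
  have "emeasure (jump_measure M j) (closure U \<times> closure V) \<le> jump_integral M j \<phi>"
    unfolding nn_integral_indicator[OF meas, symmetric]
  proof (subst jump_integral_eq, measurable, rule nn_integral_mono)
    fix z
    have "ennreal ((\<phi> (fst z) - \<phi> (snd z))\<^sup>2) = 1" if "z \<in> closure U \<times> closure V"
    proof -
      have "\<phi> (fst z) = 1" using that by (auto intro: \<phi>(2))
      moreover have "\<phi> (snd z) = 0" using that V(4) AB(5) by (intro \<phi>(3)) auto
      ultimately show ?thesis by simp
    qed
    then show "indicator (closure U \<times> closure V) z \<le> ennreal ((\<phi> (fst z) - \<phi> (snd z))\<^sup>2)"
      by (cases "z \<in> closure U \<times> closure V") auto
  qed
  also have "\<dots> < \<infinity>" using \<phi>(1) by (simp add: jump_predomain_def)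
  finally show "\<exists>W. open W \<and> z \<in> W \<and> compact (closure W) \<and> closure W \<subseteq> - Id \<and>
      emeasure (jump_measure M j) (closure W) < \<infinity>"
    using U V z off
    by (intro exI[of _ "U \<times> V"]) (auto simp: closure_Times open_Times compact_Times)
qed

lemma jump_measure_swap:
  assumes B: "B \<in> sets (jump_measure M j)"
  shows "emeasure (jump_measure M j) (prod.swap ` B) = emeasure (jump_measure M j) B"
proof -
  have B': "B \<in> sets borel" "B \<subseteq> - Id"
    using B borel_open[OF open_off_diagonal] unfolding sets_jump_measure
    by (auto simp: sets_restrict_space_iff)
  have sw: "prod.swap ` B = (\<lambda>z. (snd z, fst z)) -` B" for B :: "('a \<times> 'a) set"
    by force
  have "(\<lambda>z::'a \<times> 'a. (snd z, fst z)) \<in> borel \<rightarrow>\<^sub>M borel"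
    by (intro borel_measurable_continuous_onI continuous_intros)
  from measurable_sets_borel[OF this B'(1)] have swB: "prod.swap ` B \<in> sets borel"
    unfolding sw .
  have "prod.swap ` B \<subseteq> - Id" using B'(2) by auto
  with swB have swB': "prod.swap ` B \<in> sets (jump_measure M j)"
    using borel_open[OF open_off_diagonal] unfolding sets_jump_measure
    by (auto simp: sets_restrict_space_iff)
  have [measurable]: "B \<in> sets (M \<Otimes>\<^sub>M M)" "prod.swap ` B \<in> sets (M \<Otimes>\<^sub>M M)"
    using B' swB unfolding sets_MM by auto
  let ?g = "\<lambda>z. indicator (prod.swap ` B) z * j (fst z) (snd z) * indicator (- Id) z"
  have [measurable]: "?g \<in> borel_measurable (M \<Otimes>\<^sub>M M)" by measurable
  have "emeasure (jump_measure M j) (prod.swap ` B) = (\<integral>\<^sup>+z. ?g z \<partial>(M \<Otimes>\<^sub>M M))"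
    by (rule emeasure_jump_measure[OF swB'])
  also have "\<dots> = (\<integral>\<^sup>+z. ?g z \<partial>distr (M \<Otimes>\<^sub>M M) (M \<Otimes>\<^sub>M M) (\<lambda>(x, y). (y, x)))"
    by (subst distr_pair_swap) (rule refl)
  also have "\<dots> = (\<integral>\<^sup>+z. ?g (case z of (x, y) \<Rightarrow> (y, x)) \<partial>(M \<Otimes>\<^sub>M M))"
    by (rule nn_integral_distr[OF measurable_pair_swap']) measurable
  also have "\<dots> = (\<integral>\<^sup>+z. indicator B z * j (fst z) (snd z) * indicator (- Id) z \<partial>(M \<Otimes>\<^sub>M M))"
    by (intro nn_integral_cong) (auto simp: indicator_def kernel_symmetric sw split: prod.splits)
  also have "\<dots> = emeasure (jump_measure M j) B"
    by (rule emeasure_jump_measure[OF B, symmetric])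
  finally show ?thesis .
qed

text \<open>
  The formula holds for any measurable version \<open>v\<close> of \<open>u\<close>, because \<open>J\<close> ignores changes on \<open>M\<close>-null sets.
\<close>

lemma beurling_deny_jump_form:
  "beurling_deny M (jump_domain M j) (jump_form M j) (jump_measure M j) (\<lambda>u v B. 0) (null_measure M)"
proof -
  have "strongly_local_measure_form M (jump_domain M j) (\<lambda>u v B. 0)"
    unfolding strongly_local_measure_form_def by simp
  moreover have "radon_measure (null_measure M)"
    unfolding radon_measure_on_def by (simp add: cSUP_const[of "{K. compact K \<and> K \<subseteq> _}"] exI[of _ "{}"])
  moreover have "ennreal (jump_form M j u) =
      (\<integral>\<^sup>+z. ennreal ((v (fst z) - v (snd z))\<^sup>2) \<partial>jump_measure M j)"
    if "u \<in> jump_domain M j" "qc_version M (jump_domain M j) (jump_form M j) u v" for u v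
  proof -
    have v: "v \<in> borel_measurable M" "AE x in M. u x = v x"
      using that(2) unfolding qc_version_def by blast+
    show ?thesis
      unfolding jump_form_eq[OF that(1)] jump_integral_eq[OF v(1), symmetric]
      by (rule jump_integral_cong_AE[OF jump_domain_measurable[OF that(1)] v])
  qed
  ultimately show ?thesis
    unfolding beurling_deny_def using radon_jump_measure jump_measure_swap
    by (simp add: nn_integral_null_measure)
qed

lemma zero_in_domain: "(\<lambda>x. 0) \<in> jump_domain M j"
proof -
  have "(\<lambda>x. 0) \<in> jump_predomain M j"
    by (simp add: jump_predomain_def Cc_def jump_integral_def)
  then show ?thesis using predomain_subset_domain by (rule subsetD[rotated])
qed

text \<open>
  The exceptional set may be taken empty, since the zero function shows that the empty set has capacity
  zero.
\<close>

lemma continuous_imp_qc_version: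
  assumes f: "continuous_on UNIV f"
  shows "qc_version M (jump_domain M j) (jump_form M j) f f"
proof -
  have "open_capacity M (jump_domain M j) (jump_form M j) {} \<le>
      ennreal (jump_form M j (\<lambda>x. 0)) + sq_norm_L2 M (\<lambda>x. 0)"
    unfolding open_capacity_def using zero_in_domain by (intro INF_lower) simp
  also have "\<dots> = 0"
    using jump_form_eq[OF zero_in_domain] by (simp add: jump_integral_def sq_norm_L2_def)
  finally have "quasi_continuous M (jump_domain M j) (jump_form M j) f"
    unfolding quasi_continuous_def using f by (auto intro!: exI[of _ "{}"])
  then show ?thesis
    unfolding qc_version_def using continuous_measurable[OF f] by simp
qed

text \<open>
  Every quasi-continuous representative agrees with \<open>f\<close> almost everywhere, so \<open>f\<close> itself computes the
  energy measure.
\<close>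

lemma mu_b_continuous:
  assumes f: "continuous_on UNIV f"
  shows "mu_b M (jump_domain M j) (jump_form M j) (jump_measure M j) f B =
    (\<integral>\<^sup>+z\<in>B \<times> UNIV. ennreal ((f (fst z) - f (snd z))\<^sup>2) \<partial>jump_measure M j)"
proof -
  let ?v = "qc_rep M (jump_domain M j) (jump_form M j) f"
  have "qc_version M (jump_domain M j) (jump_form M j) f ?v"
    unfolding qc_rep_def by (rule someI[where P = "qc_version _ _ _ f", OF continuous_imp_qc_version[OF f]])
  then have "AE x in M. f x = ?v x" unfolding qc_version_def by simp
  from AE_jump_measure[OF this] show ?thesis
    unfolding mu_b_def by (intro nn_integral_cong_AE) (auto elim!: AE_mp)
qed

end


section \<open>Truncated distance functions\<close>

lemma truncated_dist_bounds:
  assumes "T > 0"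
  shows "0 \<le> truncated_dist \<rho> A T x" "truncated_dist \<rho> A T x \<le> T"
  unfolding truncated_dist_def using assms
  by (auto intro: enn2real_leI)

text \<open>
  The triangle inequality passes to the infimum and to the minimum with \<open>T\<close>; for empty \<open>A\<close> the function is the
  constant \<open>T\<close>.
\<close>

lemma truncated_dist_lipschitz:
  assumes \<rho>: "pseudo_metric \<rho>" and "T > 0"
  shows "ennreal \<bar>truncated_dist \<rho> A T x - truncated_dist \<rho> A T y\<bar> \<le> \<rho> x y"
proof -
  let ?f = "truncated_dist \<rho> A T"
  have inf: "(INF a\<in>A. \<rho> x a) \<le> \<rho> x y + (INF a\<in>A. \<rho> y a)" for x y
  proof (cases "\<rho> x y = top")
    case False
    have "(INF a\<in>A. \<rho> x a) - \<rho> x y \<le> \<rho> y a" if "a \<in> A" for a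
    proof -
      have "(INF a\<in>A. \<rho> x a) \<le> \<rho> x a" using that by (rule INF_lower)
      also have "\<dots> \<le> \<rho> x y + \<rho> y a" using \<rho> unfolding pseudo_metric_def by blast
      finally show ?thesis using False by (simp add: ennreal_minus_le_iff)
    qed
    then have "(INF a\<in>A. \<rho> x a) - \<rho> x y \<le> (INF a\<in>A. \<rho> y a)" by (rule INF_greatest)
    then show ?thesis by (simp add: ennreal_minus_le_iff)
  qed simp
  have f_eq: "ennreal (?f x) = min (INF a\<in>A. \<rho> x a) (ennreal T)" for x
    unfolding truncated_dist_def by (intro ennreal_enn2real) (simp add: min_less_iff_disj)
  have step: "ennreal (?f x) \<le> \<rho> x y + ennreal (?f y)" for x y
  proof (cases "(INF a\<in>A. \<rho> y a) \<le> ennreal T")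
    case True
    have "min (INF a\<in>A. \<rho> x a) (ennreal T) \<le> (INF a\<in>A. \<rho> x a)" by simp
    also note inf[of x y]
    finally show ?thesis unfolding f_eq using True by (simp add: min_def)
  next
    case False
    have "min (INF a\<in>A. \<rho> x a) (ennreal T) \<le> ennreal T" by simp
    also have "\<dots> \<le> \<rho> x y + ennreal T" by simp
    finally show ?thesis unfolding f_eq using False by (simp add: min_def)
  qed
  show ?thesis
  proof (cases "\<rho> x y")
    case (real r)
    have "\<rho> y x = ennreal r" using real \<rho> by (simp add: pseudo_metric_def)
    have "?f x \<le> r + ?f y"
      using step[of x y] real truncated_dist_bounds(1)[OF \<open>T > 0\<close>, of \<rho> A]
      by (simp flip: ennreal_plus)
    moreover have "?f y \<le> r + ?f x"
      using step[of y x] real \<open>\<rho> y x = ennreal r\<close> truncated_dist_bounds(1)[OF \<open>T > 0\<close>, of \<rho> A]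
      by (simp flip: ennreal_plus)
    ultimately show ?thesis using real by (simp add: ennreal_leI)
  qed simp
qed

text \<open>
  Continuity of \<open>\<rho>\<close> at \<open>(x, x)\<close>, where it vanishes, forces \<open>f y\<close> to approach \<open>f x\<close>.
\<close>

lemma lipschitz_imp_continuous_on:
  fixes f :: "'b::metric_space \<Rightarrow> real"
  assumes \<rho>: "pseudo_metric \<rho>" "continuous_on UNIV (\<lambda>z. \<rho> (fst z) (snd z))"
    and lip: "\<And>x y. ennreal \<bar>f x - f y\<bar> \<le> \<rho> x y"
  shows "continuous_on UNIV f"
  unfolding continuous_on
proof (intro ballI)
  fix x :: 'b
  have "continuous_on UNIV (\<lambda>y. \<rho> (fst (y, x)) (snd (y, x)))"
    by (rule continuous_on_compose2[OF \<rho>(2)]) (auto intro!: continuous_intros)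
  then have "((\<lambda>y. \<rho> y x) \<longlongrightarrow> \<rho> x x) (at x)"
    by (simp add: continuous_on)
  then have "((\<lambda>y. \<rho> y x) \<longlongrightarrow> 0) (at x)"
    using \<rho>(1) by (simp add: pseudo_metric_def)
  then have "((\<lambda>y. ennreal \<bar>f y - f x\<bar>) \<longlongrightarrow> 0) (at x)"
    by (rule tendsto_sandwich[OF _ _ tendsto_const, rotated 2]) (auto simp: lip)
  then have "((\<lambda>y. enn2real (ennreal \<bar>f y - f x\<bar>)) \<longlongrightarrow> 0) (at x)"
    by (intro tendsto_enn2real) auto
  then have "((\<lambda>y. f y - f x) \<longlongrightarrow> 0) (at x)"
    by (simp add: tendsto_rabs_zero_iff)
  then show "(f \<longlongrightarrow> f x) (at x within UNIV)" by (simp add: LIM_zero_iff)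
qed


section \<open>Functions that are Lipschitz with respect to the metric\<close>

locale jump_kernel_metric = jump_kernel M j
    for M :: "'a::{metric_space, second_countable_topology} measure" and j +
  fixes \<rho> :: "'a \<Rightarrow> 'a \<Rightarrow> ennreal"
  assumes pseudo_metric: "pseudo_metric \<rho>"
    and continuous_metric: "continuous_on UNIV (\<lambda>z. \<rho> (fst z) (snd z))"
    and metric_bound: "AE x in M. (\<integral>\<^sup>+y\<in>- {x}. (\<rho> x y)\<^sup>2 * j x y \<partial>M) \<le> 1"
begin

text \<open>
  By Tonelli the left side is an integral over \<open>B\<close> of inner integrals that are dominated by those in the
  hypothesis on \<open>\<rho>\<close>, hence by \<open>1\<close>.
\<close>

lemma lipschitz_energy_le:
  assumes f: "f \<in> borel_measurable M" and lip: "\<And>x y. ennreal \<bar>f x - f y\<bar> \<le> \<rho> x y"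
    and B: "B \<in> sets borel"
  shows "(\<integral>\<^sup>+z\<in>B \<times> UNIV. ennreal ((f (fst z) - f (snd z))\<^sup>2) \<partial>jump_measure M j) \<le> emeasure M B"
proof -
  note [measurable] = f
  have [measurable]: "B \<in> sets M" using B by simp
  let ?g = "\<lambda>z. ennreal ((f (fst z) - f (snd z))\<^sup>2) * indicator (B \<times> UNIV) z * j (fst z) (snd z) * indicator (- Id) z"
  have [measurable]: "B \<times> UNIV \<in> sets (M \<Otimes>\<^sub>M M)"
    by (intro pair_measureI) (use B in auto)
  have [measurable]: "?g \<in> borel_measurable (M \<Otimes>\<^sub>M M)" by measurable
  have sq: "ennreal ((f x - f y)\<^sup>2) \<le> (\<rho> x y)\<^sup>2" for x y
  proof -
    have "ennreal ((f x - f y)\<^sup>2) = (ennreal \<bar>f x - f y\<bar>)\<^sup>2"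
      by (simp add: ennreal_power)
    also have "\<dots> \<le> (\<rho> x y)\<^sup>2" by (intro power_mono lip) simp
    finally show ?thesis .
  qed
  have "(\<integral>\<^sup>+z\<in>B \<times> UNIV. ennreal ((f (fst z) - f (snd z))\<^sup>2) \<partial>jump_measure M j) =
      (\<integral>\<^sup>+z. ?g z \<partial>(M \<Otimes>\<^sub>M M))"
    by (subst nn_integral_jump_measure) measurable
  also have "\<dots> = (\<integral>\<^sup>+x. \<integral>\<^sup>+y. ?g (x, y) \<partial>M \<partial>M)"
    by (rule M1.nn_integral_fst[symmetric]) measurable
  also have "\<dots> \<le> (\<integral>\<^sup>+x. indicator B x \<partial>M)"
  proof (rule nn_integral_mono_AE)
    show "AE x in M. (\<integral>\<^sup>+y. ?g (x, y) \<partial>M) \<le> indicator B x"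
      using metric_bound
    proof eventually_elim
      case (elim x)
      show ?case
      proof (cases "x \<in> B")
        case True
        have "(\<integral>\<^sup>+y. ?g (x, y) \<partial>M) \<le> (\<integral>\<^sup>+y\<in>- {x}. (\<rho> x y)\<^sup>2 * j x y \<partial>M)"
          by (rule nn_integral_mono) (auto simp: indicator_def intro!: mult_right_mono sq)
        with elim True show ?thesis by simp
      qed simp
    qed
  qed
  also have "\<dots> = emeasure M B" by (rule nn_integral_indicator) measurable
  finally show ?thesis .
qed

text \<open>
  The Leibniz rule for differences splits the energy into \<open>2 C\<^sup>2\<close> times the energy of \<open>\<phi>\<close> and twice the energy of
  \<open>f\<close> over the support of \<open>\<phi>\<close>; the latter set is compact and so has finite measure.
\<close>

lemma lipschitz_times_cutoff:
  assumes lip: "\<And>x y. ennreal \<bar>f x - f y\<bar> \<le> \<rho> x y" and bound: "\<And>x. \<bar>f x\<bar> \<le> C"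
    and \<phi>: "\<phi> \<in> jump_predomain M j" "\<And>x. \<bar>\<phi> x\<bar> \<le> 1"
  shows "(\<lambda>x. f x * \<phi> x) \<in> jump_predomain M j"
proof -
  have cont: "continuous_on UNIV f"
    by (rule lipschitz_imp_continuous_on[OF pseudo_metric continuous_metric lip])
  have f [measurable]: "f \<in> borel_measurable M" by (rule continuous_measurable[OF cont])
  note [measurable] = predomain_measurable[OF \<phi>(1)]
  let ?K = "closure {x. \<phi> x \<noteq> 0}"
  have K: "compact ?K" "continuous_on UNIV \<phi>" using \<phi>(1) by (auto simp: jump_predomain_def Cc_def)
  have \<phi>_K: "\<phi> x = 0" if "x \<notin> ?K" for x using that closure_subset[of "{x. \<phi> x \<noteq> 0}"] by blast
  have [measurable]: "?K \<times> UNIV \<in> sets (M \<Otimes>\<^sub>M M)"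
    by (intro pair_measureI) auto
  then have [measurable]: "indicator (?K \<times> UNIV) \<in> borel_measurable (jump_measure M j)"
    by (intro measurable_jump_measure borel_measurable_indicator)
  have "(\<lambda>x. f x * \<phi> x) \<in> Cc"
    by (rule compact_support_imp_Cc[OF _ K(1)]) (auto intro!: continuous_intros cont K(2) \<phi>_K)
  moreover have "jump_integral M j (\<lambda>x. f x * \<phi> x) < \<infinity>"
  proof -
    have "jump_integral M j (\<lambda>x. f x * \<phi> x) \<le>
        (\<integral>\<^sup>+z. ennreal (2 * C\<^sup>2) * ennreal ((\<phi> (fst z) - \<phi> (snd z))\<^sup>2) +
          2 * (ennreal ((f (fst z) - f (snd z))\<^sup>2) * indicator (?K \<times> UNIV) z) \<partial>jump_measure M j)"
    proof (subst jump_integral_eq, measurable, rule nn_integral_mono)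
      fix z :: "'a \<times> 'a"
      obtain x y where z: "z = (x, y)" by (cases z)
      have "f x * \<phi> x - f y * \<phi> y = f y * (\<phi> x - \<phi> y) + \<phi> x * (f x - f y)"
        by (simp add: algebra_simps)
      then have "(f x * \<phi> x - f y * \<phi> y)\<^sup>2 \<le> 2 * (f y * (\<phi> x - \<phi> y))\<^sup>2 + 2 * (\<phi> x * (f x - f y))\<^sup>2"
        using square_perturbation[of 1 "f y * (\<phi> x - \<phi> y) + \<phi> x * (f x - f y)" "f y * (\<phi> x - \<phi> y)"] by simp
      moreover have "(f y * (\<phi> x - \<phi> y))\<^sup>2 \<le> C\<^sup>2 * (\<phi> x - \<phi> y)\<^sup>2"
        unfolding power_mult_distrib using power_mono[OF bound abs_ge_zero, of y 2]
        by (intro mult_right_mono) auto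
      moreover have "(\<phi> x * (f x - f y))\<^sup>2 \<le> (f x - f y)\<^sup>2 * indicator (?K \<times> UNIV) z"
      proof (cases "x \<in> ?K")
        case True
        have "(\<phi> x)\<^sup>2 \<le> 1" using power_mono[OF \<phi>(2) abs_ge_zero, of x 2] by simp
        then have "(\<phi> x)\<^sup>2 * (f x - f y)\<^sup>2 \<le> 1 * (f x - f y)\<^sup>2"
          by (rule mult_right_mono) simp
        with True show ?thesis by (simp add: z power_mult_distrib)
      next
        case False
        show ?thesis unfolding \<phi>_K[OF False] by simp
      qed
      ultimately have "(f x * \<phi> x - f y * \<phi> y)\<^sup>2 \<le>
          2 * (C\<^sup>2 * (\<phi> x - \<phi> y)\<^sup>2) + 2 * ((f x - f y)\<^sup>2 * indicator (?K \<times> UNIV) z)"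
        by linarith
      then have "ennreal ((f x * \<phi> x - f y * \<phi> y)\<^sup>2) \<le>
          ennreal (2 * (C\<^sup>2 * (\<phi> x - \<phi> y)\<^sup>2) + 2 * ((f x - f y)\<^sup>2 * indicator (?K \<times> UNIV) z))"
        by (rule ennreal_leI)
      then show "ennreal ((f (fst z) * \<phi> (fst z) - f (snd z) * \<phi> (snd z))\<^sup>2) \<le>
          ennreal (2 * C\<^sup>2) * ennreal ((\<phi> (fst z) - \<phi> (snd z))\<^sup>2) +
          2 * (ennreal ((f (fst z) - f (snd z))\<^sup>2) * indicator (?K \<times> UNIV) z)"
        by (simp add: z ennreal_mult ennreal_indicator mult.assoc)
    qed
    also have "\<dots> = ennreal (2 * C\<^sup>2) * jump_integral M j \<phi> +
        2 * (\<integral>\<^sup>+z\<in>?K \<times> UNIV. ennreal ((f (fst z) - f (snd z))\<^sup>2) \<partial>jump_measure M j)"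
      by (simp add: nn_integral_add nn_integral_cmult jump_integral_eq)
    also have "\<dots> < \<infinity>"
    proof -
      have "(\<integral>\<^sup>+z\<in>?K \<times> UNIV. ennreal ((f (fst z) - f (snd z))\<^sup>2) \<partial>jump_measure M j) < \<infinity>"
        using lipschitz_energy_le[OF f lip, of ?K] finite_on_compact[OF K(1)]
        by (auto intro: le_less_trans)
      then show ?thesis using \<phi>(1) by (simp add: jump_predomain_def ennreal_mult_less_top)
    qed
    finally show ?thesis .
  qed
  ultimately show ?thesis by (simp add: jump_predomain_def)
qed

lemma bounded_lipschitz_in_D_loc:
  assumes lip: "\<And>x y. ennreal \<bar>f x - f y\<bar> \<le> \<rho> x y" and bound: "\<And>x. \<bar>f x\<bar> \<le> C"
  shows "f \<in> D_loc M (jump_domain M j)"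
proof -
  have cont: "continuous_on UNIV f"
    by (rule lipschitz_imp_continuous_on[OF pseudo_metric continuous_metric lip])
  have [measurable]: "f \<in> borel_measurable M" by (rule continuous_measurable[OF cont])
  have "(\<integral>\<^sup>+x\<in>K. ennreal ((f x)\<^sup>2) \<partial>M) < \<infinity>" if K: "compact K" for K
  proof -
    have "(\<integral>\<^sup>+x\<in>K. ennreal ((f x)\<^sup>2) \<partial>M) \<le> (\<integral>\<^sup>+x\<in>K. ennreal (C\<^sup>2) \<partial>M)"
      using power_mono[OF bound abs_ge_zero, of _ 2]
      by (intro nn_integral_mono mult_right_mono ennreal_leI) auto
    also have "\<dots> = ennreal (C\<^sup>2) * emeasure M K"
      using borel_compact[OF K] by (simp add: nn_integral_cmult_indicator)
    also have "\<dots> < \<infinity>" using finite_on_compact[OF K] by (simp add: ennreal_mult_less_top)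
    finally show ?thesis .
  qed
  moreover have "\<exists>v\<in>jump_domain M j. AE x in M. x \<in> G \<longrightarrow> f x = v x" if G: "compact (closure G)" for G
  proof -
    obtain \<phi> where \<phi>: "\<phi> \<in> jump_predomain M j" "\<And>x. 0 \<le> \<phi> x" "\<And>x. \<phi> x \<le> 1" "\<And>x. x \<in> closure G \<Longrightarrow> \<phi> x = 1"
      using jump_predomain_cutoff[OF G open_UNIV subset_UNIV] by metis
    have "(\<lambda>x. f x * \<phi> x) \<in> jump_domain M j"
      using lipschitz_times_cutoff[OF lip bound \<phi>(1)] \<phi>(2,3) predomain_subset_domain by auto
    moreover have "f x = f x * \<phi> x" if "x \<in> G" for x
      using \<phi>(4)[of x] closure_subset[of G] that by auto
    ultimately show ?thesis by (intro bexI[of _ "\<lambda>x. f x * \<phi> x"]) auto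
  qed
  ultimately show ?thesis unfolding D_loc_def L2_loc_def by simp
qed

text \<open>
  The defining property forces the measure to vanish on Borel subsets of relatively compact open sets, and countably
  many of those cover the space. Membership of \<open>f\<close> in the local domain is essential: it supplies the functions \<open>v\<close>
  without which the property would say nothing.
\<close>

lemma mu_c_zero:
  assumes f: "f \<in> D_loc M (jump_domain M j)"
  shows "mu_c M (jump_domain M j) (\<lambda>u v B. 0) f = null_measure M"
  unfolding mu_c_def
proof (rule the_equality)
  fix N :: "'a measure"
  assume N: "sets N = sets borel \<and>
      (\<forall>G v. open G \<and> compact (closure G) \<and> v \<in> jump_domain M j \<and> (AE x in M. x \<in> G \<longrightarrow> f x = v x) \<longrightarrow>
        (\<forall>B\<in>sets borel. B \<subseteq> G \<longrightarrow> emeasure N B = ennreal 0))"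
  obtain U :: "nat \<Rightarrow> 'a set" where U: "\<And>n. open (U n)" "\<And>n. compact (closure (U n))" "(\<Union>n. U n) = UNIV"
    using exhaustion by metis
  have zero: "emeasure N B = 0" if B: "B \<in> sets borel" for B
  proof -
    have "emeasure N (B \<inter> U n) = 0" for n
    proof -
      obtain v where v: "v \<in> jump_domain M j" "AE x in M. x \<in> U n \<longrightarrow> f x = v x"
        using f U unfolding D_loc_def by blast
      have "B \<inter> U n \<in> sets borel" using B borel_open[OF U(1)] by (rule sets.Int)
      moreover have "\<forall>B\<in>sets borel. B \<subseteq> U n \<longrightarrow> emeasure N B = ennreal 0"
        using N U(1)[of n] U(2)[of n] v by blast
      ultimately have "emeasure N (B \<inter> U n) = ennreal 0" by blast
      then show ?thesis by simp
    qed
    then have "emeasure N (\<Union>n. B \<inter> U n) = 0"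
      using N B U(1) by (intro emeasure_UN_eq_0) auto
    moreover have "(\<Union>n. B \<inter> U n) = B" using U(3) by blast
    ultimately show ?thesis by simp
  qed
  show "N = null_measure M"
    by (rule measure_eqI) (use N zero in auto)
qed simp

theorem intrinsic_metric_jump_form:
  "intrinsic_metric M (jump_domain M j) (jump_form M j) (jump_measure M j) (\<lambda>u v B. 0) (null_measure M) \<rho>"
proof -
  let ?D = "jump_domain M j" and ?E = "jump_form M j" and ?J = "jump_measure M j"
  have main: "truncated_dist \<rho> A T \<in> D_loc_star M ?D ?E ?J \<and>
      continuous_on UNIV (truncated_dist \<rho> A T) \<and>
      (\<forall>B\<in>sets borel. mu_b M ?D ?E ?J (truncated_dist \<rho> A T) B \<le> emeasure M B) \<and>
      (\<forall>B\<in>sets borel. emeasure (mu_c M ?D (\<lambda>u v B. 0) (truncated_dist \<rho> A T)) B \<le> emeasure (null_measure M) B)"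
    if "T > 0" for A T
  proof -
    let ?f = "truncated_dist \<rho> A T"
    note lip = truncated_dist_lipschitz[OF pseudo_metric \<open>T > 0\<close>, of A]
    have cont: "continuous_on UNIV ?f"
      by (rule lipschitz_imp_continuous_on[OF pseudo_metric continuous_metric lip])
    have f: "?f \<in> borel_measurable M" by (rule continuous_measurable[OF cont])
    have loc: "?f \<in> D_loc M ?D"
      by (rule bounded_lipschitz_in_D_loc[OF lip, of T])
         (use truncated_dist_bounds[OF \<open>T > 0\<close>, of \<rho> A] in auto)
    have le: "mu_b M ?D ?E ?J ?f B \<le> emeasure M B" if "B \<in> sets borel" for B
      unfolding mu_b_continuous[OF cont] using lipschitz_energy_le[OF f lip that] .
    have "mu_b M ?D ?E ?J ?f K < \<infinity>" if "compact K" for K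
      using le[OF borel_compact[OF that]] finite_on_compact[OF that] by (rule le_less_trans)
    then have "?f \<in> D_loc_star M ?D ?E ?J"
      using loc unfolding D_loc_star_def mu_b_def by simp
    with cont le show ?thesis by (simp add: mu_c_zero[OF loc])
  qed
  have "radon_measure (null_measure M)"
    using beurling_deny_jump_form unfolding beurling_deny_def by simp
  then show ?thesis
    unfolding intrinsic_metric_def
    using beurling_deny_jump_form pseudo_metric radon main
    by (intro conjI exI[of _ M] exI[of _ "null_measure M"]) auto
qed

end

theorem theorem7p3:
  fixes M :: "'a::{metric_space, second_countable_topology} measure"
    and j :: "'a \<Rightarrow> 'a \<Rightarrow> ennreal"
    and \<rho> :: "'a \<Rightarrow> 'a \<Rightarrow> ennreal"
  assumes "locally_compact_space (euclidean :: 'a topology)"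
    and "radon_measure M"
    and "measure_support M = UNIV"
    and "(\<lambda>z. j (fst z) (snd z)) \<in> borel_measurable (borel :: ('a \<times> 'a) measure)"
    and "\<And>x y. j x y = j y x"
    and "\<And>x y. x \<noteq> y \<Longrightarrow> j x y < \<infinity>"
    and "\<And>f e. f \<in> Cc \<Longrightarrow> e > 0 \<Longrightarrow> \<exists>u\<in>jump_predomain M j. \<forall>x. \<bar>f x - u x\<bar> < e"
    and "pseudo_metric \<rho>"
    and "continuous_on UNIV (\<lambda>z. \<rho> (fst z) (snd z))"
    and "AE x in M. (\<integral>\<^sup>+y\<in>- {x}. (\<rho> x y)\<^sup>2 * j x y \<partial>M) \<le> 1"
  shows "intrinsic_metric M (jump_domain M j) (jump_form M j)
           (jump_measure M j) (\<lambda>u v B. 0) (null_measure M) \<rho>"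
proof -
  interpret jump_kernel_metric M j \<rho>
    by unfold_locales (fact assms)+
  show ?thesis by (rule intrinsic_metric_jump_form)
qed

end
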